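(* Let $k\ge 1$ be an integer, let $0\le n\le k$, let $a,b,c$ be heights with $b-c=k-2n$, and set $$\alpha=\frac{-u+a-k+1}{2},\qquad \beta=\frac{-u+b-k+1}{2},\qquad \gamma=\frac{-u-b-k+1}{2}.$$ Then $$C^k_n(\alpha,\beta,\gamma)=\sum_{\mu\in\{-k,-k+2,\dots,k\}}\psi^{*(k)}_\mu(u)^c_b\,\psi^{(k)}_\mu(u)^a_{a+k}.$$
   Context: Theta functions. Fix $\tau\in\mathbb{C}$ with $\mathrm{Im}\,\tau>0$ and a nonzero parameter $r$; put $\tilde p=e^{2\pi i\tau}$, $x=e^{-\pi i/(r\tau)}$ (powers $x^s=e^{-\pi i s/(r\tau)}$). Let $\vartheta_1(u|\tau)=2\tilde p^{1/8}(\tilde p;\tilde p)_\infty\sin\pi u\prod_{n\ge1}(1-2\tilde p^n\cos 2\pi u+\tilde p^{2n})$, $\vartheta_0(u|\tau)=-ie^{\pi i(u+\tau/4)}\vartheta_1(u+\frac{\tau}{2}|\tau)$, $\vartheta_3(u|\tau)=e^{\pi i(u+\tau/4)}\vartheta_1(u+\frac{\tau+1}{2}|\tau)$. Set $[u]=C\,\vartheta_1(\frac{u}{r}|\tau)$ with $C=x^{-r/4}e^{-\pi i/4}\tau^{1/2}$, $[u]_n=\prod_{j=0}^{n-1}[u+j]$, and $[u_1,\dots,u_s]_n=\prod_{i=1}^s[u_i]_n$. Elliptic binomial coefficients. For $0\le n\le k$, $$C_n^k(\alpha,\beta,\gamma)=\frac{[1]_k}{[1]_n[1]_{k-n}}\,\frac{[\alpha-\gamma,\alpha+\gamma+k-n]_n\,[\alpha-\beta,\alpha+\beta+n]_{k-n}}{[\beta-\gamma+n-k]_n\,[\gamma-\beta-n]_{k-n}\,[\beta+\gamma]_k};$$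 these are the coefficients in $[\alpha+rz]_k[\alpha-rz]_k=\sum_{n=0}^kC_n^k(\alpha,\beta,\gamma)[\beta+rz]_n[\beta-rz]_n[\gamma+rz]_{k-n}[\gamma-rz]_{k-n}$. Intertwining vectors. Heights are integers. For heights with $|a-b|=1$ let $\psi_+(u)^a_b=\vartheta_0\big(\frac{(a-b)u+a}{2r}\big|\frac{\tau}{2}\big)$, $\psi_-(u)^a_b=\vartheta_3\big(\frac{(a-b)u+a}{2r}\big|\frac{\tau}{2}\big)$, and, for $\varepsilon=\pm$ (identified with $\pm1$), $\psi^*_\varepsilon(u)^a_b=-\varepsilon\,\frac{a-b}{2[b][u]}\,C^2\,\psi_{-\varepsilon}(u-1)^a_b$. Fusion. For $a-b\in\{-k,-k+2,\dots,k\}$ and $\mu\in\{-k,-k+2,\dots,k\}$, $$\psi^{(k)}_\mu(u)^a_b=\sum_{\varepsilon_1+\cdots+\varepsilon_k=\mu}\psi_{\varepsilon_1}(u+k-1)^a_{c_1}\psi_{\varepsilon_2}(u+k-2)^{c_1}_{c_2}\cdots\psi_{\varepsilon_k}(u)^{c_{k-1}}_b,$$ which is independent of the choice of $c_1,\dots,c_{k-1}$ with $|a-c_1|=|c_1-c_2|=\cdots=|c_{k-1}-b|=1$; and $$\psi^{*(k)}_\mu(u)^b_a=\sum_{c_1,\dots,c_{k-1}}\psi^*_{\varepsilon_1}(u+k-1)^{c_1}_a\psi^*_{\varepsilon_2}(u+k-2)^{c_2}_{c_1}\cdots\psi^*_{\varepsilon_k}(u)^b_{c_{k-1}},$$ summed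 over all $c_1,\dots,c_{k-1}$ with consecutive heights in $a,c_1,\dots,c_{k-1},b$ differing by $\pm1$, which is independent of the choice of $\varepsilon_1,\dots,\varepsilon_k\in\{\pm1\}$ with $\varepsilon_1+\cdots+\varepsilon_k=\mu$. Genericity. Parameters are generic, so that no denominator vanishes: $\frac{b+j}{r}\notin\mathbb{Z}+\tau\mathbb{Z}$ for $j=1-k,\dots,k-1$, $\frac{u+j}{r}\notin\mathbb{Z}+\tau\mathbb{Z}$ for $j=0,\dots,k-1$, and $\frac{j}{r}\notin\mathbb{Z}+\tau\mathbb{Z}$ for $j=1,\dots,k$. *)

theory Defs
  imports "HOL-Analysis.Analysis" "HOL-Library.FuncSet"
begin

section \<open>Theta functions\<close>

definition nome :: "complex \<Rightarrow> complex" where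
  "nome \<tau> = exp (2 * of_real pi * \<i> * \<tau>)"

text \<open>The fractional power \<open>nome \<tau> ^ (1/8)\<close> is read as \<open>exp (2 \<pi> \<i> \<tau> / 8)\<close>.
  The products over \<open>n \<ge> 1\<close> are shifted to start at \<open>0\<close>. They may have a zero factor,
  which \<^const>\<open>prodinf\<close> handles (the product is then \<open>0\<close>).\<close>

definition theta1 :: "complex \<Rightarrow> complex \<Rightarrow> complex" where
  "theta1 u \<tau> =
     2 * exp (2 * of_real pi * \<i> * \<tau> / 8) * prodinf (\<lambda>n. 1 - nome \<tau> * nome \<tau> ^ n) *
     sin (of_real pi * u) *
     prodinf (\<lambda>n. 1 - 2 * nome \<tau> ^ Suc n * cos (2 * of_real pi * u) + nome \<tau> ^ (2 * Suc n))"

definition theta0 :: "complex \<Rightarrow> complex \<Rightarrow> complex" where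
  "theta0 u \<tau> = - \<i> * exp (of_real pi * \<i> * (u + \<tau> / 4)) * theta1 (u + \<tau> / 2) \<tau>"

definition theta3 :: "complex \<Rightarrow> complex \<Rightarrow> complex" where
  "theta3 u \<tau> = exp (of_real pi * \<i> * (u + \<tau> / 4)) * theta1 (u + (\<tau> + 1) / 2) \<tau>"


section \<open>Elliptic numbers and elliptic binomial coefficients\<close>

text \<open>\<open>xpow r \<tau> s\<close> is \<open>x\<^sup>s\<close> for \<open>x = exp (- \<pi> \<i> / (r \<tau>))\<close>.\<close>

definition xpow :: "complex \<Rightarrow> complex \<Rightarrow> complex \<Rightarrow> complex" where
  "xpow r \<tau> s = exp (- (of_real pi * \<i> * s / (r * \<tau>)))"

definition Cnorm :: "complex \<Rightarrow> complex \<Rightarrow> complex" where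
  "Cnorm r \<tau> = xpow r \<tau> (- r / 4) * exp (- (of_real pi * \<i> / 4)) * csqrt \<tau>"

definition br :: "complex \<Rightarrow> complex \<Rightarrow> complex \<Rightarrow> complex" where
  "br r \<tau> u = Cnorm r \<tau> * theta1 (u / r) \<tau>"

definition brp :: "complex \<Rightarrow> complex \<Rightarrow> complex \<Rightarrow> nat \<Rightarrow> complex" where
  "brp r \<tau> u n = (\<Prod>j<n. br r \<tau> (u + of_nat j))"

definition ell_binom ::
  "complex \<Rightarrow> complex \<Rightarrow> nat \<Rightarrow> nat \<Rightarrow> complex \<Rightarrow> complex \<Rightarrow> complex \<Rightarrow> complex" where
  "ell_binom r \<tau> k n \<alpha> \<beta> \<gamma> =
     brp r \<tau> 1 k / (brp r \<tau> 1 n * brp r \<tau> 1 (k - n)) *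
     ((brp r \<tau> (\<alpha> - \<gamma>) n * brp r \<tau> (\<alpha> + \<gamma> + of_nat k - of_nat n) n *
       brp r \<tau> (\<alpha> - \<beta>) (k - n) * brp r \<tau> (\<alpha> + \<beta> + of_nat n) (k - n)) /
      (brp r \<tau> (\<beta> - \<gamma> + of_nat n - of_nat k) n *
       brp r \<tau> (\<gamma> - \<beta> - of_nat n) (k - n) *
       brp r \<tau> (\<beta> + \<gamma>) k))"


section \<open>Intertwining vectors\<close>

text \<open>A sign is an element of \<open>{1, -1} :: int set\<close>. In \<open>psi r \<tau> \<epsilon> u a b\<close> and
  \<open>psi_star r \<tau> \<epsilon> u a b\<close> the height \<open>a\<close> is the superscript and \<open>b\<close> the subscript; the
  values are meaningful for \<open>\<bar>a - b\<bar> = 1\<close>.\<close>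

definition psi :: "complex \<Rightarrow> complex \<Rightarrow> int \<Rightarrow> complex \<Rightarrow> int \<Rightarrow> int \<Rightarrow> complex" where
  "psi r \<tau> \<epsilon> u a b =
     (if \<epsilon> = 1 then theta0 ((of_int (a - b) * u + of_int a) / (2 * r)) (\<tau> / 2)
      else theta3 ((of_int (a - b) * u + of_int a) / (2 * r)) (\<tau> / 2))"

definition psi_star :: "complex \<Rightarrow> complex \<Rightarrow> int \<Rightarrow> complex \<Rightarrow> int \<Rightarrow> int \<Rightarrow> complex" where
  "psi_star r \<tau> \<epsilon> u a b =
     - of_int \<epsilon> * (of_int (a - b) / (2 * br r \<tau> (of_int b) * br r \<tau> u)) *
     (Cnorm r \<tau>)\<^sup>2 * psi r \<tau> (- \<epsilon>) (u - 1) a b"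


section \<open>Fusion\<close>

definition sign_seqs :: "nat \<Rightarrow> int \<Rightarrow> (nat \<Rightarrow> int) set" where
  "sign_seqs k \<mu> = {\<epsilon> \<in> {..<k} \<rightarrow>\<^sub>E {1, -1}. (\<Sum>i<k. \<epsilon> i) = \<mu>}"

definition height_paths :: "nat \<Rightarrow> int \<Rightarrow> int \<Rightarrow> (nat \<Rightarrow> int) set" where
  "height_paths k a b =
     {h \<in> {..k} \<rightarrow>\<^sub>E UNIV. h 0 = a \<and> h k = b \<and> (\<forall>i<k. \<bar>h i - h (Suc i)\<bar> = 1)}"

lemma finite_sign_seqs: "finite (sign_seqs k \<mu>)"
proof -
  have "finite ({..<k} \<rightarrow>\<^sub>E {1, -1 :: int})"
    by (intro finite_PiE) auto
  thus ?thesis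
    unfolding sign_seqs_def by simp
qed

lemma finite_height_paths: "finite (height_paths k a b)"
proof -
  have "height_paths k a b \<subseteq> {..k} \<rightarrow>\<^sub>E {a - int k..a + int k}"
  proof
    fix h assume h: "h \<in> height_paths k a b"
    have bound: "\<bar>h i - a\<bar> \<le> int i" if "i \<le> k" for i
      using that
    proof (induction i)
      case 0
      thus ?case using h by (simp add: height_paths_def)
    next
      case (Suc i)
      hence "\<bar>h i - h (Suc i)\<bar> = 1"
        using h by (simp add: height_paths_def)
      thus ?case using Suc by auto
    qed
    have "h i \<in> {a - int k..a + int k}" if "i \<le> k" for i
      using bound[OF that] that by auto
    thus "h \<in> {..k} \<rightarrow>\<^sub>E {a - int k..a + int k}"
      using h by (auto simp: height_paths_def PiE_iff)
  qed
  thus ?thesis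
    by (rule finite_subset) (intro finite_PiE, auto)
qed

text \<open>The fused vector along a given path \<open>h 0 = a, h 1, \<dots>, h k = b\<close>, and the fused dual vector
  for a given sign sequence; the factor with index \<open>i = 0, \<dots>, k - 1\<close> has spectral parameter
  \<open>u + k - 1 - i\<close>. In the dual vector the path runs from the subscript to the superscript.\<close>

definition psi_along ::
  "complex \<Rightarrow> complex \<Rightarrow> nat \<Rightarrow> int \<Rightarrow> complex \<Rightarrow> (nat \<Rightarrow> int) \<Rightarrow> complex" where
  "psi_along r \<tau> k \<mu> u h =
     (\<Sum>\<epsilon>\<in>sign_seqs k \<mu>. \<Prod>i<k. psi r \<tau> (\<epsilon> i) (u + of_nat k - 1 - of_nat i) (h i) (h (Suc i)))"

definition psi_star_along ::
  "complex \<Rightarrow> complex \<Rightarrow> nat \<Rightarrow> (nat \<Rightarrow> int) \<Rightarrow> complex \<Rightarrow> int \<Rightarrow> int \<Rightarrow> complex" where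
  "psi_star_along r \<tau> k \<epsilon> u b a =
     (\<Sum>h\<in>height_paths k a b.
        \<Prod>i<k. psi_star r \<tau> (\<epsilon> i) (u + of_nat k - 1 - of_nat i) (h (Suc i)) (h i))"

text \<open>The fused vectors are the common value over all admissible choices (of the path, and of the
  sign sequence, respectively). The definite description asserts nothing by itself: a statement
  about these values can only be proved by also establishing the independence of the choice.
  First height argument: superscript; second: subscript.\<close>

definition psi_fused ::
  "complex \<Rightarrow> complex \<Rightarrow> nat \<Rightarrow> int \<Rightarrow> complex \<Rightarrow> int \<Rightarrow> int \<Rightarrow> complex" where
  "psi_fused r \<tau> k \<mu> u a b = (THE v. \<forall>h\<in>height_paths k a b. v = psi_along r \<tau> k \<mu> u h)"

definition psi_star_fused ::
  "complex \<Rightarrow> complex \<Rightarrow> nat \<Rightarrow> int \<Rightarrow> complex \<Rightarrow> int \<Rightarrow> int \<Rightarrow> complex" where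
  "psi_star_fused r \<tau> k \<mu> u b a = (THE v. \<forall>\<epsilon>\<in>sign_seqs k \<mu>. v = psi_star_along r \<tau> k \<epsilon> u b a)"

text \<open>The index set \<open>{-k, -k + 2, \<dots>, k}\<close>.\<close>

definition fusion_weights :: "nat \<Rightarrow> int set" where
  "fusion_weights k = (\<lambda>j. 2 * int j - int k) ` {..k}"


section \<open>Genericity\<close>

definition period_lattice :: "complex \<Rightarrow> complex set" where
  "period_lattice \<tau> = {of_int m + of_int n * \<tau> | m n. True}"

definition generic_params :: "complex \<Rightarrow> complex \<Rightarrow> nat \<Rightarrow> complex \<Rightarrow> int \<Rightarrow> bool" where
  "generic_params r \<tau> k u b \<longleftrightarrow>
     (\<forall>j\<in>{1 - int k..int k - 1}. (of_int b + of_int j) / r \<notin> period_lattice \<tau>) \<and>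
     (\<forall>j\<in>{0..<k}. (u + of_nat j) / r \<notin> period_lattice \<tau>) \<and>
     (\<forall>j\<in>{1..k}. of_nat j / r \<notin> period_lattice \<tau>)"

end

theory Submission
  imports Defs
begin

text \<open>
  The right-hand side is a sum over lattice paths. Since \<open>a + k\<close> is as far from \<open>a\<close> as \<open>k\<close> steps
  reach, \<open>psi_fused r \<tau> k \<mu> u a (a + k)\<close> runs along a single path. As \<open>\<mu>\<close> varies, its sign sequences
  exhaust \<open>{1, -1}\<^sup>k\<close>, so the signs may be summed independently, step by step. This leaves a sum
  over the height paths from \<open>b\<close> to \<open>c\<close>, in which step \<open>i\<close> carries the weight
  \<open>\<Sum>\<epsilon>. \<psi>\<^sup>*\<^sub>\<epsilon> \<psi>\<^sub>\<epsilon>\<close> taken at spectral parameter \<open>u + k - 1 - i\<close> (\<open>fused_pairing_eq_path_sum\<close>).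

  The analytic heart is one addition formula (\<open>theta_addition\<close>):
  \<open>\<theta>\<^sub>3(x|\<tau>/2) \<theta>\<^sub>0(y|\<tau>/2) - \<theta>\<^sub>0(x|\<tau>/2) \<theta>\<^sub>3(y|\<tau>/2) = -2 \<theta>\<^sub>1(x+y|\<tau>) \<theta>\<^sub>1(x-y|\<tau>)\<close>. It is used three times.
  It evaluates the weight of a step as a quotient of elliptic numbers (\<open>psi_pairing\<close>). It shows that
  two adjacent dual vectors can exchange their signs once the height between them is summed over, so
  that the fused dual vector depends on the total \<open>\<mu>\<close> only (\<open>dual_sum_swap\<close>,
  \<open>dual_sum_depends_on_weight\<close>). And its left-hand side is a two-by-two determinant in \<open>x\<close> and \<open>y\<close>,
  so the Pluecker relation for such determinants is the Weierstrass three-term relation for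
  \<open>\<theta>\<^sub>1\<close> (\<open>theta1_three_term\<close>).

  The path sum is then computed by induction on the number of steps (\<open>path_sum_eq_ell_binom\<close>). If
  \<open>v = u + k - 1\<close> is kept fixed, then \<open>\<alpha> = (a - v)/2\<close>, \<open>\<beta> = (b - v)/2\<close> and \<open>\<gamma> = (-b - v)/2\<close> do not
  change with \<open>k\<close>, and the last step of a path goes up or down. So the claim is that the elliptic
  binomial coefficients satisfy a Pascal recursion with these step weights (\<open>ell_binom_Suc_Suc\<close>).
  After common factors are cancelled, this recursion is an instance of the three-term relation.

  The addition formula is a rearrangement of double series. The theta functions are given by
  products, which are expanded by the Jacobi triple product identity, itself the limit of Cauchy's
  \<open>q\<close>-binomial theorem under Tannery's theorem. The product form also shows that \<open>\<theta>\<^sub>1\<close> vanishes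
  only on the period lattice (\<open>theta1_eq_0_imp_period\<close>), so that genericity makes the
  denominators nonzero.
\<close>

section \<open>The q-binomial theorem and a finite triple product\<close>

text \<open>The shifted factorial \<open>(q; q)\<^sub>n\<close>.\<close>

definition qfact :: "complex \<Rightarrow> nat \<Rightarrow> complex" where
  "qfact q n = (\<Prod>i<n. 1 - q ^ Suc i)"

definition qbinom :: "complex \<Rightarrow> nat \<Rightarrow> nat \<Rightarrow> complex" where
  "qbinom q m j = (if j \<le> m then qfact q m / (qfact q j * qfact q (m - j)) else 0)"

lemma qfact_0 [simp]: "qfact q 0 = 1"
  by (simp add: qfact_def)

lemma qfact_Suc: "qfact q (Suc n) = qfact q n * (1 - q ^ Suc n)"
  by (simp add: qfact_def)

lemma one_minus_power_nonzero:
  assumes "norm (q::complex) < 1"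
  shows "1 - q ^ Suc n \<noteq> 0"
proof
  assume "1 - q ^ Suc n = 0"
  then have "norm q ^ Suc n = 1" by (metis eq_iff_diff_eq_0 norm_one norm_power)
  moreover have "norm q ^ Suc n < 1"
    using assms by (metis norm_ge_zero power_less_one_iff zero_less_Suc)
  ultimately show False by simp
qed

lemma qfact_nonzero: "norm q < 1 \<Longrightarrow> qfact q n \<noteq> 0"
  unfolding qfact_def using one_minus_power_nonzero by simp

lemma qbinom_0: "norm q < 1 \<Longrightarrow> qbinom q m 0 = 1"
  by (simp add: qbinom_def qfact_nonzero)

lemma qbinom_Suc_Suc:
  assumes q: "norm q < 1" and "j \<le> m"
  shows "qbinom q (Suc m) (Suc j) = qbinom q m (Suc j) + q ^ (m - j) * qbinom q m j"
proof (cases "j = m")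
  case True
  then show ?thesis by (simp add: qbinom_def qfact_nonzero[OF q])
next
  case False
  then obtain l where m: "m = Suc (j + l)"
    using assms(2) by (metis le_neq_implies_less less_imp_Suc_add)
  have nz: "qfact q i \<noteq> 0" "1 - q ^ Suc i \<noteq> 0" for i
    using qfact_nonzero[OF q] one_minus_power_nonzero[OF q] by auto
  have "qbinom q (Suc m) (Suc j) =
      qfact q m * (1 - q ^ (Suc j + Suc l)) / (qfact q j * (1 - q ^ Suc j) * (qfact q l * (1 - q ^ Suc l)))"
    by (simp add: qbinom_def m qfact_Suc)
  also have "1 - q ^ (Suc j + Suc l) = (1 - q ^ Suc l) + q ^ Suc l * (1 - q ^ Suc j)"
    by (simp add: power_add algebra_simps)
  also have "qfact q m * (1 - q ^ Suc l + q ^ Suc l * (1 - q ^ Suc j)) /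
        (qfact q j * (1 - q ^ Suc j) * (qfact q l * (1 - q ^ Suc l))) =
      qfact q m / (qfact q j * (1 - q ^ Suc j) * qfact q l) +
      q ^ Suc l * (qfact q m / (qfact q j * (qfact q l * (1 - q ^ Suc l))))"
    using nz(1)[of j] nz(1)[of l] nz(2)[of j] nz(2)[of l]
    by (simp add: divide_simps del: power_Suc) (simp add: algebra_simps)
  also have "\<dots> = qbinom q m (Suc j) + q ^ (m - j) * qbinom q m j"
    by (simp add: qbinom_def m qfact_Suc Suc_diff_le)
  finally show ?thesis .
qed

text \<open>Comparing coefficients of \<open>y\<^sup>j\<^sup>+\<^sup>1\<close> after multiplication by the next factor \<open>1 + q\<^sup>m y\<close> gives
  the Pascal rule \<open>qbinom_Suc_Suc\<close>.\<close>

lemma q_binomial_theorem: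
  assumes q: "norm q < 1"
  shows "(\<Prod>i<m. 1 + q ^ i * y) = (\<Sum>j\<le>m. qbinom q m j * q ^ (j choose 2) * y ^ j)"
proof (induction m)
  case 0
  then show ?case by (simp add: qbinom_0[OF q] binomial_eq_0)
next
  case (Suc m)
  define t where "t j = qbinom q m j * q ^ (j choose 2) * y ^ j" for j
  have choose: "Suc j choose 2 = j + (j choose 2)" for j
    by (simp add: numeral_2_eq_2)
  have step: "qbinom q (Suc m) (Suc j) * q ^ (Suc j choose 2) * y ^ Suc j
      = t (Suc j) + q ^ m * y * t j" if "j \<le> m" for j
  proof -
    have "q ^ m = q ^ (m - j) * q ^ j" using that by (simp flip: power_add)
    then show ?thesis
      unfolding t_def qbinom_Suc_Suc[OF q that] choose
      by (simp add: power_add algebra_simps)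
  qed
  have "(\<Sum>j\<le>Suc m. qbinom q (Suc m) j * q ^ (j choose 2) * y ^ j)
      = 1 + (\<Sum>j\<le>m. t (Suc j) + q ^ m * y * t j)"
    by (subst sum.atMost_Suc_shift) (simp add: qbinom_0[OF q] step binomial_eq_0 del: power_Suc)
  also have "\<dots> = (1 + (\<Sum>j\<le>m. t (Suc j))) + q ^ m * y * (\<Sum>j\<le>m. t j)"
    by (simp add: sum.distrib sum_distrib_left)
  also have "1 + (\<Sum>j\<le>m. t (Suc j)) = (\<Sum>j\<le>Suc m. t j)"
    by (subst sum.atMost_Suc_shift) (simp add: t_def qbinom_0[OF q] binomial_eq_0)
  also have "\<dots> = (\<Sum>j\<le>m. t j)"
    by (simp add: t_def qbinom_def)
  finally show ?case
    using Suc.IH by (simp add: t_def algebra_simps)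
qed

text \<open>The summand \<open>q\<^sup>m\<^sup>(\<^sup>m\<^sup>+\<^sup>1\<^sup>)\<^sup>/\<^sup>2 w\<^sup>m\<close> of the triple product series for \<open>q = exp (2\<pi>\<i>\<tau>)\<close> and \<open>w = exp (2\<pi>\<i>u)\<close>. The
  exponential form avoids negative and half-integral powers.\<close>

definition triple_term :: "complex \<Rightarrow> complex \<Rightarrow> int \<Rightarrow> complex" where
  "triple_term \<tau> u m = exp (of_real pi * \<i> * (of_int (m * (m + 1)) * \<tau> + 2 * of_int m * u))"

lemma norm_nome_less_1: "Im \<tau> > 0 \<Longrightarrow> norm (nome \<tau>) < 1"
  by (simp add: nome_def)

lemma nome_power: "nome \<tau> ^ n = exp (2 * of_real pi * \<i> * (of_nat n * \<tau>))"
  unfolding nome_def by (simp flip: exp_of_nat_mult add: algebra_simps)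

text \<open>The \<open>q\<close>-binomial theorem with \<open>2N\<close> factors, centred: for \<open>y = w q\<^sup>1\<^sup>-\<^sup>N\<close> the upper half of the factors
  \<open>1 + q\<^sup>i y\<close> is already of the form \<open>1 + q\<^sup>n\<^sup>+\<^sup>1 w\<close>. The lower half is \<open>1 + w q\<^sup>-\<^sup>n\<close>, which becomes \<open>1 + q\<^sup>n/w\<close>
  after a monomial is extracted. These monomials multiply to the constant \<open>G\<close> of the proof and complete
  the square in the exponents on the other side.\<close>

lemma finite_triple_product:
  fixes u \<tau> :: complex and N :: nat
  assumes "Im \<tau> > 0"
  defines "q \<equiv> nome \<tau>" and "w \<equiv> exp (2 * of_real pi * \<i> * u)"
  shows "(\<Prod>n<N. (1 + q ^ Suc n * w) * (1 + q ^ n / w)) =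
     (\<Sum>m\<in>{- int N..int N}. qbinom q (2 * N) (nat (m + int N)) * triple_term \<tau> u m)"
proof -
  define e :: "complex \<Rightarrow> complex" where "e z = exp (2 * of_real pi * \<i> * z)" for z
  have e_add: "e (x + y) = e x * e y" for x y
    by (simp add: e_def algebra_simps exp_add)
  have e_pow: "e x ^ n = e (of_nat n * x)" for x n
    by (simp add: e_def algebra_simps flip: exp_of_nat_mult)
  have e_nz: "e x \<noteq> 0" for x by (simp add: e_def)
  have q_pow: "q ^ n = e (of_nat n * \<tau>)" for n
    by (simp add: q_def nome_power e_def)
  have w: "w = e u" by (simp add: w_def e_def)
  define y where "y = e (u + (1 - of_nat N) * \<tau>)"
  define G where "G = e (of_nat N * u - of_nat (N choose 2) * \<tau>)"
  have two_choose: "2 * (of_nat (j choose 2) :: complex) = of_nat j * (of_nat j - 1)" for j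
    by (induction j) (simp_all add: numeral_2_eq_2 algebra_simps binomial_eq_0)
  have G: "(\<Prod>n<N. e (u - of_nat n * \<tau>)) = G"
    unfolding G_def
    by (induction N) (simp_all add: e_add[symmetric] numeral_2_eq_2 binomial_eq_0, simp add: e_def, simp add: algebra_simps)
  have split: "(\<Prod>i<N+M. f i) = (\<Prod>i<N. f i) * (\<Prod>i<M. f (N + i))" for f :: "nat \<Rightarrow> complex" and M
    by (induction M) (simp_all add: algebra_simps)
  have low: "(\<Prod>i<N. 1 + q ^ i * y) = G * (\<Prod>n<N. 1 + q ^ n / w)"
  proof -
    have "(\<Prod>i<N. 1 + q ^ i * y) = (\<Prod>i<N. 1 + q ^ (N - Suc i) * y)"
      by (rule prod.nat_diff_reindex[symmetric])
    also have "\<dots> = (\<Prod>n<N. e (u - of_nat n * \<tau>) * (1 + q ^ n / w))"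
    proof (rule prod.cong)
      fix n assume "n \<in> {..<N}"
      then have "(of_nat (N - Suc n) :: complex) = of_nat N - 1 - of_nat n"
        by (simp add: of_nat_diff)
      then have "q ^ (N - Suc n) * y = e (u - of_nat n * \<tau>)"
        unfolding q_pow y_def e_add[symmetric] by (simp only:) (simp add: algebra_simps)
      moreover have "e (u - of_nat n * \<tau>) * (q ^ n / w) = 1"
      proof -
        have "e (u - of_nat n * \<tau>) * q ^ n = w"
          unfolding q_pow w by (simp add: e_add[symmetric])
        then show ?thesis using e_nz w by simp
      qed
      ultimately show "1 + q ^ (N - Suc n) * y = e (u - of_nat n * \<tau>) * (1 + q ^ n / w)"
        by (simp add: distrib_left)
    qed simp
    finally show ?thesis by (simp add: prod.distrib G)
  qed
  have high: "q ^ (N + i) * y = q ^ Suc i * w" for i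
    unfolding q_pow y_def w by (simp add: e_add[symmetric] algebra_simps)
  have "G * (\<Prod>n<N. (1 + q ^ Suc n * w) * (1 + q ^ n / w)) = (\<Prod>i<N+N. 1 + q ^ i * y)"
    unfolding split low high by (simp add: prod.distrib)
  also have "\<dots> = (\<Sum>j\<le>2*N. qbinom q (2*N) j * q ^ (j choose 2) * y ^ j)"
    using q_binomial_theorem[of q y "N+N"] norm_nome_less_1[OF assms(1)]
    by (simp add: q_def mult_2)
  also have "\<dots> = (\<Sum>j\<le>2*N. G * (qbinom q (2*N) j * triple_term \<tau> u (int j - int N)))"
  proof (rule sum.cong)
    fix j assume "j \<in> {..2*N}"
    have "q ^ (j choose 2) * y ^ j = e (of_nat (j choose 2) * \<tau> + of_nat j * (u + (1 - of_nat N) * \<tau>))"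
      unfolding q_pow y_def e_pow by (simp add: e_add)
    moreover have "triple_term \<tau> u (int j - int N) =
        e ((of_nat j - of_nat N) * (of_nat j - of_nat N + 1) / 2 * \<tau> + (of_nat j - of_nat N) * u)"
      unfolding triple_term_def e_def by (rule arg_cong[where f = exp]) (simp add: field_simps)
    then have "G * triple_term \<tau> u (int j - int N) =
        e (of_nat N * u - of_nat (N choose 2) * \<tau> +
           ((of_nat j - of_nat N) * (of_nat j - of_nat N + 1) / 2 * \<tau> + (of_nat j - of_nat N) * u))"
      by (simp only: G_def e_add)
    moreover have "of_nat (j choose 2) * \<tau> + of_nat j * (u + (1 - of_nat N) * \<tau>) =
        of_nat N * u - of_nat (N choose 2) * \<tau> +
           ((of_nat j - of_nat N) * (of_nat j - of_nat N + 1) / 2 * \<tau> + (of_nat j - of_nat N) * u)"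
    proof -
      have c: "(of_nat (i choose 2) :: complex) = of_nat i * (of_nat i - 1) / 2" for i
        using two_choose[of i] by (simp add: field_simps)
      show ?thesis unfolding c by (simp add: field_simps)
    qed
    ultimately have "q ^ (j choose 2) * y ^ j = G * triple_term \<tau> u (int j - int N)"
      by simp
    then show "qbinom q (2*N) j * q ^ (j choose 2) * y ^ j =
        G * (qbinom q (2*N) j * triple_term \<tau> u (int j - int N))"
      by (simp add: mult.assoc)
  qed simp
  also have "\<dots> = G * (\<Sum>m\<in>{- int N..int N}. qbinom q (2 * N) (nat (m + int N)) * triple_term \<tau> u m)"
    unfolding sum_distrib_left[symmetric]
    by (intro arg_cong[where f = "(*) G"] sum.reindex_bij_witness[of _ "\<lambda>m. nat (m + int N)" "\<lambda>j. int j - int N"]) auto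
  finally show ?thesis using e_nz by (simp add: G_def)
qed

section \<open>The Jacobi triple product\<close>

lemma convergent_prod_one_plus_geometric:
  assumes "norm (q::complex) < 1"
  shows "convergent_prod (\<lambda>n. 1 + c * q ^ n)"
proof (rule abs_convergent_prod_imp_convergent_prod)
  have "summable (\<lambda>n. norm c * norm q ^ n)"
    using assms by (intro summable_mult summable_geometric) simp
  then show "abs_convergent_prod (\<lambda>n. 1 + c * q ^ n)"
    unfolding abs_convergent_prod_conv_summable by (simp add: norm_mult norm_power)
qed

lemma prod_one_plus_geometric_LIMSEQ:
  assumes "norm (q::complex) < 1"
  shows "(\<lambda>N. \<Prod>n<N. 1 + c * q ^ n) \<longlonglongrightarrow> prodinf (\<lambda>n. 1 + c * q ^ n)"
  using convergent_prod_has_prod[OF convergent_prod_one_plus_geometric[OF assms]]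
  by (rule has_prod_imp_tendsto')

text \<open>The quadratic exponent \<open>- A m\<^sup>2 + B m\<close> lies below \<open>D - |m|\<close> for a constant \<open>D\<close>, so a geometric series
  dominates. The series is indexed by \<^typ>\<open>nat\<close> because Tannery's theorem is stated for such series.\<close>

lemma summable_triple_term:
  assumes "Im \<tau> > 0"
  shows "summable (\<lambda>k. norm (triple_term \<tau> u (int_decode k)))"
proof -
  define A where "A = pi * Im \<tau>"
  define B where "B = - pi * (Im \<tau> + 2 * Im u)"
  \<comment> \<open>the maximum of \<open>- A t\<^sup>2 + (\<bar>B\<bar> + 1) t\<close>, by completing the square\<close>
  define D where "D = (\<bar>B\<bar> + 1)\<^sup>2 / (4 * A)"
  have A: "A > 0" using assms by (simp add: A_def)
  have bound: "norm (triple_term \<tau> u m) \<le> exp (D - \<bar>real_of_int m\<bar>)" for m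
  proof -
    have "norm (triple_term \<tau> u m) = exp (- A * (real_of_int m)\<^sup>2 + B * real_of_int m)"
      by (simp add: triple_term_def A_def B_def algebra_simps power2_eq_square)
    moreover have "- A * (real_of_int m)\<^sup>2 + B * real_of_int m \<le> D - \<bar>real_of_int m\<bar>"
    proof -
      define t where "t = \<bar>real_of_int m\<bar>"
      have "D - (\<bar>B\<bar> + 1) * t + A * t\<^sup>2 = (2 * A * t - (\<bar>B\<bar> + 1))\<^sup>2 / (4 * A)"
        using A by (simp add: D_def field_simps power2_eq_square)
      also have "\<dots> \<ge> 0" using A by simp
      finally have "- A * t\<^sup>2 + \<bar>B\<bar> * t \<le> D - t" by (simp add: algebra_simps)
      moreover have "B * real_of_int m \<le> \<bar>B\<bar> * t"
        unfolding t_def by (metis abs_ge_self abs_mult)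
      ultimately show ?thesis by (simp add: t_def)
    qed
    ultimately show ?thesis by simp
  qed
  have dec: "real k \<le> 2 * \<bar>real_of_int (int_decode k)\<bar> + 1" for k
  proof -
    have "int k \<le> 2 * \<bar>int_decode k\<bar> + 1"
      unfolding int_decode_def sum_decode_def by (auto elim!: oddE evenE)
    then have "real_of_int (int k) \<le> real_of_int (2 * \<bar>int_decode k\<bar> + 1)"
      by (simp only: of_int_le_iff)
    then show ?thesis by simp
  qed
  have "norm (norm (triple_term \<tau> u (int_decode k))) \<le> exp (D + 1 / 2) * exp (- (1 / 2)) ^ k" for k
  proof -
    have "norm (triple_term \<tau> u (int_decode k)) \<le> exp (D - \<bar>real_of_int (int_decode k)\<bar>)"
      by (rule bound)
    also have "\<dots> \<le> exp (D + 1 / 2 + real k * (- (1/2)))"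
      using dec[of k] by simp
    also have "\<dots> = exp (D + 1 / 2) * exp (- (1 / 2)) ^ k"
      by (simp only: exp_add exp_of_nat_mult)
    finally show ?thesis by simp
  qed
  moreover have "summable (\<lambda>k. exp (D + 1 / 2) * exp (- (1 / 2) :: real) ^ k)"
    by (intro summable_mult summable_geometric) simp
  ultimately show ?thesis
    by (rule summable_comparison_test'[rotated])
qed

lemma qfact_LIMSEQ:
  assumes "norm q < 1"
  shows "qfact q \<longlonglongrightarrow> prodinf (\<lambda>n. 1 - q * q ^ n)"
    and "prodinf (\<lambda>n. 1 - q * q ^ n) \<noteq> 0"
proof -
  show "qfact q \<longlonglongrightarrow> prodinf (\<lambda>n. 1 - q * q ^ n)"
    using prod_one_plus_geometric_LIMSEQ[OF assms, of "- q"]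
    by (simp add: qfact_def[abs_def])
  have "convergent_prod (\<lambda>n. 1 - q * q ^ n)"
    using convergent_prod_one_plus_geometric[OF assms, of "- q"] by simp
  moreover have "1 - q * q ^ n \<noteq> 0" for n
    using one_minus_power_nonzero[OF assms, of n] by simp
  ultimately show "prodinf (\<lambda>n. 1 - q * q ^ n) \<noteq> 0"
    by (rule prodinf_nonzero)
qed

text \<open>The factorials \<open>(q; q)\<^sub>n\<close> converge to a nonzero limit, hence they and their inverses are bounded. This
  supplies the domination in the limit of the finite triple product.\<close>

lemma qbinom_bounded:
  assumes "norm q < 1"
  obtains K where "K > 0" "\<And>m j. norm (qbinom q m j) \<le> K"
proof -
  define P where "P = prodinf (\<lambda>n. 1 - q * q ^ n)"
  note lim = qfact_LIMSEQ[OF assms, folded P_def]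
  obtain K1 where K1: "K1 > 0" "\<And>n. norm (qfact q n) \<le> K1"
    using convergent_imp_Bseq[OF convergentI[OF lim(1)]] by (meson BseqE)
  have "(\<lambda>n. inverse (qfact q n)) \<longlonglongrightarrow> inverse P"
    using lim by (intro tendsto_inverse)
  then obtain K2 where K2: "K2 > 0" "\<And>n. norm (inverse (qfact q n)) \<le> K2"
    by (meson BseqE convergentI convergent_imp_Bseq)
  have "norm (qbinom q m j) \<le> K1 * (K2 * K2)" for m j
  proof (cases "j \<le> m")
    case True
    then have "norm (qbinom q m j) =
        norm (qfact q m) * (norm (inverse (qfact q j)) * norm (inverse (qfact q (m - j))))"
      by (simp add: qbinom_def norm_divide norm_mult norm_inverse divide_inverse)
    also have "\<dots> \<le> K1 * (K2 * K2)"
      using K1 K2 by (intro mult_mono) (auto intro: less_imp_le)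
    finally show ?thesis .
  next
    case False
    then show ?thesis using K1 K2 by (simp add: qbinom_def)
  qed
  then show ?thesis using that[of "K1 * (K2 * K2)"] K1(1) K2(1) by simp
qed

lemma central_qbinom_LIMSEQ:
  assumes "norm q < 1"
  shows "(\<lambda>N. qbinom q (2 * N) (nat (m + int N))) \<longlonglongrightarrow> 1 / prodinf (\<lambda>n. 1 - q * q ^ n)"
proof -
  define P where "P = prodinf (\<lambda>n. 1 - q * q ^ n)"
  note lim = qfact_LIMSEQ[OF assms, folded P_def]
  have shift: "(\<lambda>N. qfact q (nat (i + int N))) \<longlonglongrightarrow> P" for i
  proof (rule filterlim_compose[OF lim(1)])
    show "filterlim (\<lambda>N. nat (i + int N)) at_top sequentially"
      unfolding filterlim_at_top
    proof
      fix Z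
      show "\<forall>\<^sub>F N in sequentially. Z \<le> nat (i + int N)"
        using eventually_ge_at_top[of "Z + nat \<bar>i\<bar>"] by eventually_elim auto
    qed
  qed
  have double: "(\<lambda>N. qfact q (2 * N)) \<longlonglongrightarrow> P"
    by (rule filterlim_compose[OF lim(1)]) (intro mult_nat_left_at_top, simp)
  have "(\<lambda>N. qfact q (2 * N) / (qfact q (nat (m + int N)) * qfact q (nat (- m + int N))))
      \<longlonglongrightarrow> P / (P * P)"
    using lim(2) by (intro tendsto_intros double shift) auto
  moreover have "\<forall>\<^sub>F N in sequentially.
      qfact q (2 * N) / (qfact q (nat (m + int N)) * qfact q (nat (- m + int N))) =
      qbinom q (2 * N) (nat (m + int N))"
    using eventually_ge_at_top[of "nat \<bar>m\<bar>"]
  proof eventually_elim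
    case (elim N)
    then have "nat (m + int N) \<le> 2 * N" "2 * N - nat (m + int N) = nat (- m + int N)"
      by auto
    then show ?case by (simp add: qbinom_def)
  qed
  ultimately show ?thesis
    using lim(2) by (simp add: P_def[symmetric] Lim_transform_eventually)
qed

text \<open>Tannery's theorem applied to \<open>finite_triple_product\<close>: for fixed \<open>m\<close> the central \<open>q\<close>-binomial
  coefficient tends to \<open>1 / (q; q)\<^sub>\<infinity>\<close>.\<close>

theorem jacobi_triple_product:
  fixes \<tau> u :: complex
  assumes "Im \<tau> > 0"
  defines "q \<equiv> nome \<tau>" and "w \<equiv> exp (2 * of_real pi * \<i> * u)"
  shows "(triple_term \<tau> u has_sum
     prodinf (\<lambda>n. 1 - q * q ^ n) * (prodinf (\<lambda>n. 1 + q * w * q ^ n) * prodinf (\<lambda>n. 1 + inverse w * q ^ n))) UNIV"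
proof -
  have q: "norm q < 1" using norm_nome_less_1[OF assms(1)] by (simp add: q_def)
  define P where "P = prodinf (\<lambda>n. 1 - q * q ^ n)"
  define R where "R = prodinf (\<lambda>n. 1 + q * w * q ^ n) * prodinf (\<lambda>n. 1 + inverse w * q ^ n)"
  have P: "P \<noteq> 0" using qfact_LIMSEQ(2)[OF q] by (simp add: P_def)
  obtain K where K: "K > 0" "\<And>m j. norm (qbinom q m j) \<le> K"
    using qbinom_bounded[OF q] by blast
  define T where "T k = triple_term \<tau> u (int_decode k)" for k
  define a where "a k N = (if \<bar>int_decode k\<bar> \<le> int N
      then qbinom q (2 * N) (nat (int_decode k + int N)) * T k else 0)" for k N
  have T: "summable (\<lambda>k. norm (T k))"
    unfolding T_def by (rule summable_triple_term[OF assms(1)])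
  have "(\<lambda>N. \<Sum>k. a k N) \<longlonglongrightarrow> (\<Sum>k. 1 / P * T k)"
  proof -
    have lim: "a k \<longlonglongrightarrow> 1 / P * T k" for k
    proof (rule Lim_transform_eventually)
      show "(\<lambda>N. qbinom q (2 * N) (nat (int_decode k + int N)) * T k) \<longlonglongrightarrow> 1 / P * T k"
        unfolding P_def by (intro tendsto_mult_right central_qbinom_LIMSEQ q)
      show "\<forall>\<^sub>F N in sequentially. qbinom q (2 * N) (nat (int_decode k + int N)) * T k = a k N"
        using eventually_ge_at_top[of "nat \<bar>int_decode k\<bar>"]
        by eventually_elim (auto simp: a_def)
    qed
    have bound: "norm (a k N) \<le> K * norm (T k)" for k N
      using K by (auto simp: a_def norm_mult intro: mult_right_mono)
    show ?thesis
      using tannerys_theorem[OF lim, where M = "\<lambda>k. K * norm (T k)"] bound summable_mult[OF T, of K]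
      by (simp add: always_eventually case_prod_unfold)
  qed
  moreover have "(\<Sum>k. a k N) = (\<Prod>n<N. (1 + q ^ Suc n * w) * (1 + q ^ n / w))" for N
  proof -
    define S where "S = int_encode ` {- int N..int N}"
    have "(\<Sum>k. a k N) = (\<Sum>k\<in>S. a k N)"
    proof (rule suminf_finite)
      show "finite S" by (simp add: S_def)
      fix k assume "k \<notin> S"
      then have "int_decode k \<notin> {- int N..int N}"
        unfolding S_def by (metis image_eqI int_decode_inverse)
      then show "a k N = 0" by (auto simp: a_def)
    qed
    also have "\<dots> = (\<Sum>m\<in>{- int N..int N}. a (int_encode m) N)"
      unfolding S_def by (subst sum.reindex) (auto simp: inj_on_def inj_int_encode[THEN injD])
    also have "\<dots> = (\<Sum>m\<in>{- int N..int N}. qbinom q (2 * N) (nat (m + int N)) * triple_term \<tau> u m)"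
      by (rule sum.cong) (auto simp: a_def T_def)
    finally show ?thesis
      using finite_triple_product[OF assms(1), where N = N and u = u] by (simp add: q_def w_def)
  qed
  moreover have "(\<lambda>N. \<Prod>n<N. (1 + q ^ Suc n * w) * (1 + q ^ n / w)) \<longlonglongrightarrow> R"
    using tendsto_mult[OF prod_one_plus_geometric_LIMSEQ[OF q, of "q * w"]
        prod_one_plus_geometric_LIMSEQ[OF q, of "inverse w"]]
    by (simp add: R_def prod.distrib divide_inverse mult_ac)
  ultimately have "(\<Sum>k. 1 / P * T k) = R"
    by (metis (no_types, lifting) LIMSEQ_unique ext)
  moreover have "(\<Sum>k. 1 / P * T k) = 1 / P * suminf T"
    using summable_norm_cancel[OF T] by (rule suminf_mult)
  ultimately have "suminf T = P * R" using P by (simp add: field_simps)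
  then have "T sums (P * R)"
    using summable_norm_cancel[OF T] by (simp add: summable_sums_iff)
  then have "(T has_sum (P * R)) UNIV"
    using T by (rule norm_summable_imp_has_sum[rotated])
  then have "(triple_term \<tau> u has_sum (P * R)) UNIV"
    unfolding T_def
    by (simp only: has_sum_reindex_bij_betw[OF bij_int_decode, of "triple_term \<tau> u"])
  then show ?thesis by (simp add: P_def R_def)
qed

lemma abs_summable_triple_term:
  assumes "Im \<tau> > 0"
  shows "(\<lambda>m. norm (triple_term \<tau> u m)) summable_on UNIV"
proof -
  have "(\<lambda>k. norm (triple_term \<tau> u (int_decode k))) summable_on UNIV"
    using summable_triple_term[OF assms] by (intro norm_summable_imp_summable_on) simp
  then show ?thesis
    by (simp add: summable_on_reindex_bij_betw[OF bij_int_decode, of "\<lambda>m. norm (triple_term \<tau> u m)"])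
qed

section \<open>Series and zeros of the first theta function\<close>

text \<open>The summand of the classical series of \<open>\<i> \<theta>\<^sub>1\<close>.\<close>

definition theta1_term :: "complex \<Rightarrow> complex \<Rightarrow> int \<Rightarrow> complex" where
  "theta1_term \<tau> u m = (-1) powi m *
     exp (of_real pi * \<i> * ((of_int m + 1 / 2)\<^sup>2 * \<tau> + (2 * of_int m + 1) * u))"

lemma minus_one_powi: "(-1) powi m = exp (of_real pi * \<i> * of_int m)"
proof -
  obtain n where "m = int n \<or> m = - int n" by (metis int_cases2)
  then have "exp (of_int m * (of_real pi * \<i>)) = exp (of_real pi * \<i>) powi m"
    by (auto simp: power_int_minus exp_minus exp_of_nat_mult)
  then show ?thesis by (simp add: mult.commute)
qed

lemma theta1_product_factor:
  "(1 - 2 * q ^ Suc n * cos (2 * of_real pi * u) + q ^ (2 * Suc n)) =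
   (1 - q * exp (2 * of_real pi * \<i> * u) * q ^ n) * (1 - q * exp (- (2 * of_real pi * \<i> * u)) * q ^ n)"
proof -
  define e f where "e = exp (2 * of_real pi * \<i> * u)" and "f = exp (- (2 * of_real pi * \<i> * u))"
  have ef: "e * f = 1" by (simp add: e_def f_def exp_minus)
  have "2 * cos (2 * of_real pi * u) = e + f"
    unfolding e_def f_def cos_exp_eq by (simp add: mult_ac)
  moreover have "(1 - q * e * q ^ n) * (1 - q * f * q ^ n) =
     1 - q ^ Suc n * (e + f) + (e * f) * q ^ (2 * Suc n)"
    by (simp add: algebra_simps power_mult_distrib power2_eq_square power_mult power_add mult_2)
  ultimately show ?thesis
    unfolding e_def[symmetric] f_def[symmetric] by (simp add: ef mult_ac)
qed

lemma theta1_prod_eq: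
  assumes "Im \<tau> > 0"
  defines "q \<equiv> nome \<tau>"
  shows "prodinf (\<lambda>n. 1 - 2 * q ^ Suc n * cos (2 * of_real pi * u) + q ^ (2 * Suc n)) =
    prodinf (\<lambda>n. 1 - q * exp (2 * of_real pi * \<i> * u) * q ^ n) *
    prodinf (\<lambda>n. 1 - q * exp (- (2 * of_real pi * \<i> * u)) * q ^ n)"
proof -
  have q: "norm q < 1" using norm_nome_less_1[OF assms(1)] by (simp add: q_def)
  have conv: "convergent_prod (\<lambda>n. 1 - c * q ^ n)" for c
    using convergent_prod_one_plus_geometric[OF q, of "- c"] by simp
  show ?thesis
    unfolding theta1_product_factor by (rule prodinf_mult[OF conv conv, symmetric])
qed

text \<open>The triple product at \<open>w = - exp (2\<pi>\<i>u)\<close>. Its second product starts one factor earlier than the one in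
  \<open>\<theta>\<^sub>1\<close>. The additional factor \<open>1 - exp (-2\<pi>\<i>u)\<close> is the source of \<open>sin \<pi>u\<close>.\<close>

lemma theta1_series:
  assumes "Im \<tau> > 0"
  shows "(theta1_term \<tau> u has_sum \<i> * theta1 u \<tau>) UNIV"
proof -
  define q where "q = nome \<tau>"
  define z where "z = exp (2 * of_real pi * \<i> * u)"
  have q: "norm q < 1" using norm_nome_less_1[OF assms(1)] by (simp add: q_def)
  define w where "w = exp (2 * of_real pi * \<i> * (u + 1 / 2))"
  have "w = exp (of_real pi * \<i>) * z"
    unfolding w_def z_def exp_add[symmetric]
    by (rule arg_cong[where f = exp]) (simp add: algebra_simps)
  then have w: "w = - z" by simp
  have znz: "z \<noteq> 0" by (simp add: z_def)
  define P A B where "P = prodinf (\<lambda>n. 1 - q * q ^ n)"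
    and "A = prodinf (\<lambda>n. 1 - q * z * q ^ n)"
    and "B = prodinf (\<lambda>n. 1 - q * inverse z * q ^ n)"
  have shift: "prodinf (\<lambda>n. 1 - inverse z * q ^ n) = (1 - inverse z) * B"
  proof -
    have lim: "(\<lambda>N. \<Prod>n<N. 1 - c * q ^ n) \<longlonglongrightarrow> prodinf (\<lambda>n. 1 - c * q ^ n)" for c
      using prod_one_plus_geometric_LIMSEQ[OF q, of "- c"] by simp
    have "(\<lambda>N. \<Prod>n<Suc N. 1 - inverse z * q ^ n) \<longlonglongrightarrow> prodinf (\<lambda>n. 1 - inverse z * q ^ n)"
      by (rule LIMSEQ_Suc[OF lim])
    moreover have "(\<Prod>n<Suc N. 1 - inverse z * q ^ n) =
        (1 - inverse z) * (\<Prod>n<N. 1 - q * inverse z * q ^ n)" for N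
      by (subst prod.lessThan_Suc_shift) (simp add: mult_ac)
    moreover have "(\<lambda>N. (1 - inverse z) * (\<Prod>n<N. 1 - q * inverse z * q ^ n)) \<longlonglongrightarrow> (1 - inverse z) * B"
      unfolding B_def by (intro tendsto_intros lim)
    ultimately show ?thesis by (metis (no_types, lifting) LIMSEQ_unique ext)
  qed
  have "(triple_term \<tau> (u + 1 / 2) has_sum P * (A * ((1 - inverse z) * B))) UNIV"
    using jacobi_triple_product[OF assms(1), of "u + 1 / 2"]
    unfolding q_def[symmetric] w_def[symmetric] w
    by (simp add: P_def A_def shift)
  then have "((\<lambda>m. exp (of_real pi * \<i> * (\<tau> / 4 + u)) * triple_term \<tau> (u + 1 / 2) m) has_sum
      exp (of_real pi * \<i> * (\<tau> / 4 + u)) * (P * (A * ((1 - inverse z) * B)))) UNIV"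
    by (rule has_sum_cmult_right)
  moreover have "exp (of_real pi * \<i> * (\<tau> / 4 + u)) * triple_term \<tau> (u + 1 / 2) m = theta1_term \<tau> u m" for m
    unfolding triple_term_def theta1_term_def minus_one_powi exp_add[symmetric]
    by (rule arg_cong[where f = exp]) (simp add: field_simps power2_eq_square)
  moreover have "exp (of_real pi * \<i> * (\<tau> / 4 + u)) * (P * (A * ((1 - inverse z) * B))) = \<i> * theta1 u \<tau>"
  proof -
    have "exp (of_real pi * \<i> * u) * (1 - inverse z) = 2 * \<i> * sin (of_real pi * u)"
    proof -
      have "exp (of_real pi * \<i> * u) * inverse z = exp (- (of_real pi * \<i> * u))"
        unfolding z_def exp_minus[symmetric] exp_add[symmetric]
        by (rule arg_cong[where f = exp]) simp
      then show ?thesis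
        unfolding right_diff_distrib by (simp add: sin_exp_eq mult_ac)
    qed
    moreover have "exp (of_real pi * \<i> * (\<tau> / 4 + u)) =
        exp (2 * of_real pi * \<i> * \<tau> / 8) * exp (of_real pi * \<i> * u)"
      by (simp add: algebra_simps flip: exp_add)
    moreover have "theta1 u \<tau> = 2 * exp (2 * of_real pi * \<i> * \<tau> / 8) * P * sin (of_real pi * u) * (A * B)"
      unfolding theta1_def theta1_prod_eq[OF assms(1)]
      by (simp add: P_def A_def B_def q_def z_def exp_minus)
    ultimately show ?thesis by (simp add: mult_ac)
  qed
  ultimately show ?thesis by simp
qed

lemma abs_summable_theta1_term:
  assumes "Im \<tau> > 0"
  shows "(\<lambda>m. norm (theta1_term \<tau> u m)) summable_on UNIV"
proof -
  have "norm (theta1_term \<tau> u m) = norm (exp (of_real pi * \<i> * (\<tau> / 4 + u))) * norm (triple_term \<tau> u m)" for m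
    unfolding triple_term_def theta1_term_def norm_mult norm_power_int norm_mult[symmetric] exp_add[symmetric]
    by (simp add: field_simps power2_eq_square)
  then show ?thesis
    by (simp only:) (intro summable_on_cmult_right abs_summable_triple_term assms)
qed

text \<open>A convergent product vanishes only with one of its factors. The factors of \<open>\<theta>\<^sub>1\<close> that can vanish are, up
  to units, \<open>1 - q\<^sup>n exp (\<plusminus> 2\<pi>\<i>z)\<close> with \<open>n \<ge> 0\<close>, where \<open>n = 0\<close> comes from the sine.\<close>

lemma theta1_eq_0_imp_period:
  assumes "Im \<tau> > 0" and "theta1 z \<tau> = 0"
  shows "z \<in> period_lattice \<tau>"
proof -
  define q where "q = nome \<tau>"
  have q: "norm q < 1" using norm_nome_less_1[OF assms(1)] by (simp add: q_def)
  have factor: "\<exists>n. c * q ^ n = 1" if "prodinf (\<lambda>n. 1 - c * q ^ n) = 0" for c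
  proof (rule ccontr)
    assume "\<nexists>n. c * q ^ n = 1"
    then have "1 - c * q ^ n \<noteq> 0" for n by (metis eq_iff_diff_eq_0)
    moreover have "convergent_prod (\<lambda>n. 1 - c * q ^ n)"
      using convergent_prod_one_plus_geometric[OF q, of "- c"] by simp
    ultimately show False using that prodinf_nonzero by blast
  qed
  have e: "z \<in> period_lattice \<tau>"
    if e1: "exp (2 * of_real pi * \<i> * (of_int n * \<tau> + of_int s * z)) = 1" and s: "s = 1 \<or> s = -1" for n s :: int
  proof -
    obtain m :: int where
      "2 * of_real pi * \<i> * (of_int n * \<tau> + of_int s * z) = 0 + of_real (of_int (2 * m) * pi) * \<i>"
      using e1 exp_eq[of "2 * of_real pi * \<i> * (of_int n * \<tau> + of_int s * z)" 0]
      unfolding exp_zero by blast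
    then have "2 * of_real pi * \<i> * (of_int n * \<tau> + of_int s * z) = 2 * of_real pi * \<i> * of_int m"
      by (simp add: algebra_simps)
    then have "of_int n * \<tau> + of_int s * z = of_int m" by simp
    then have "z = of_int (s * m) + of_int (- s * n) * \<tau>"
      using s by (auto simp: algebra_simps)
    then show ?thesis unfolding period_lattice_def by blast
  qed
  have "sin (of_real pi * z) = 0 \<or>
    prodinf (\<lambda>n. 1 - q * exp (2 * of_real pi * \<i> * z) * q ^ n) = 0 \<or>
    prodinf (\<lambda>n. 1 - q * exp (- (2 * of_real pi * \<i> * z)) * q ^ n) = 0"
    using assms(2) qfact_LIMSEQ(2)[OF q]
    unfolding q_def theta1_def theta1_prod_eq[OF assms(1)] by auto
  then consider "sin (of_real pi * z) = 0"
    | n where "q * exp (2 * of_real pi * \<i> * z) * q ^ n = 1"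
    | n where "q * exp (- (2 * of_real pi * \<i> * z)) * q ^ n = 1"
    using factor by blast
  then show ?thesis
  proof cases
    case 1
    then obtain m :: int where "of_real pi * z = of_real (of_int m * pi)"
      unfolding sin_eq_0 by auto
    then have "z = of_int m + of_int 0 * \<tau>" by simp
    then show ?thesis unfolding period_lattice_def by blast
  next
    case 2
    have "exp (2 * of_real pi * \<i> * (of_int (int (Suc n)) * \<tau> + of_int 1 * z)) =
        q ^ Suc n * exp (2 * of_real pi * \<i> * z)"
      unfolding q_def nome_power exp_add[symmetric] by (simp add: algebra_simps)
    then show ?thesis using 2 e[of "int (Suc n)" 1] by (simp add: mult_ac)
  next
    case 3
    have "exp (2 * of_real pi * \<i> * (of_int (int (Suc n)) * \<tau> + of_int (-1) * z)) =
        q ^ Suc n * exp (- (2 * of_real pi * \<i> * z))"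
      unfolding q_def nome_power exp_add[symmetric] by (simp add: algebra_simps)
    then show ?thesis using 3 e[of "int (Suc n)" "-1"] by (simp add: mult_ac)
  qed
qed

lemma theta1_minus: "theta1 (- u) \<tau> = - theta1 u \<tau>"
  by (simp add: theta1_def)

section \<open>The addition formula and the three-term relation\<close>

definition theta3_term :: "complex \<Rightarrow> complex \<Rightarrow> int \<Rightarrow> complex" where
  "theta3_term \<tau> u m = exp (of_real pi * \<i> * ((of_int m)\<^sup>2 * \<tau> + 2 * of_int m * u))"

text \<open>Shifting the argument by \<open>\<tau>/2\<close> turns the half-integral exponents of \<open>\<theta>\<^sub>1\<close> into integral ones. For
  \<open>\<theta>\<^sub>3\<close> below, the further shift by \<open>1/2\<close> cancels the alternating signs.\<close>

lemma theta0_series: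
  assumes "Im \<tau> > 0"
  shows "((\<lambda>m. (-1) powi m * theta3_term \<tau> u m) has_sum theta0 u \<tau>) UNIV"
proof -
  define c where "c = - exp (of_real pi * \<i> * (u + \<tau> / 4))"
  have "((\<lambda>m. c * theta1_term \<tau> (u + \<tau> / 2) m) has_sum c * (\<i> * theta1 (u + \<tau> / 2) \<tau>)) UNIV"
    by (intro has_sum_cmult_right theta1_series assms)
  moreover have "c * theta1_term \<tau> (u + \<tau> / 2) m = (-1) powi (m + 1) * theta3_term \<tau> u (m + 1)" for m
  proof -
    have "(-1 :: complex) powi (m + 1) = - ((-1) powi m)"
      by (simp add: power_int_add)
    moreover have "exp (of_real pi * \<i> * (u + \<tau> / 4)) *
        exp (of_real pi * \<i> * ((of_int m + 1 / 2)\<^sup>2 * \<tau> + (2 * of_int m + 1) * (u + \<tau> / 2))) =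
        theta3_term \<tau> u (m + 1)"
      unfolding theta3_term_def exp_add[symmetric]
      by (rule arg_cong[where f = exp]) (simp add: field_simps power2_eq_square)
    ultimately show ?thesis
      unfolding c_def theta1_term_def by (simp add: mult_ac)
  qed
  moreover have "c * (\<i> * theta1 (u + \<tau> / 2) \<tau>) = theta0 u \<tau>"
    by (simp add: theta0_def c_def)
  ultimately have "((\<lambda>m. (-1) powi (m + 1) * theta3_term \<tau> u (m + 1)) has_sum theta0 u \<tau>) UNIV"
    by simp
  then show ?thesis
    by (subst (asm) has_sum_reindex_bij_witness[where i = "\<lambda>m. m - 1" and j = "\<lambda>m. m + 1" and T = UNIV
          and h = "\<lambda>m. (-1) powi m * theta3_term \<tau> u m" and s' = "theta0 u \<tau>"]) auto
qed

lemma theta3_series: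
  assumes "Im \<tau> > 0"
  shows "(theta3_term \<tau> u has_sum theta3 u \<tau>) UNIV"
proof -
  define c where "c = - \<i> * exp (of_real pi * \<i> * (u + \<tau> / 4))"
  have c: "c = exp (- (of_real pi * \<i> / 2)) * exp (of_real pi * \<i> * (u + \<tau> / 4))"
  proof -
    have "exp (- (of_real pi * \<i> / 2)) = - \<i>"
      using cis_conv_exp[of "- (pi / 2)"] by (simp add: mult.commute)
    then show ?thesis by (simp add: c_def)
  qed
  have "((\<lambda>m. c * theta1_term \<tau> (u + (\<tau> + 1) / 2) m) has_sum c * (\<i> * theta1 (u + (\<tau> + 1) / 2) \<tau>)) UNIV"
    by (intro has_sum_cmult_right theta1_series assms)
  moreover have "c * theta1_term \<tau> (u + (\<tau> + 1) / 2) m = theta3_term \<tau> u (m + 1)" for m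
  proof -
    have "c * theta1_term \<tau> (u + (\<tau> + 1) / 2) m =
        exp (2 * of_int m * of_real pi * \<i>) * theta3_term \<tau> u (m + 1)"
      unfolding c theta1_term_def theta3_term_def minus_one_powi exp_add[symmetric]
      by (rule arg_cong[where f = exp]) (simp add: field_simps power2_eq_square)
    moreover have "exp (2 * of_int m * of_real pi * \<i>) = 1"
      using exp_integer_2pi[of "of_int m"] by (simp add: mult_ac)
    ultimately show ?thesis by simp
  qed
  moreover have "c * (\<i> * theta1 (u + (\<tau> + 1) / 2) \<tau>) = theta3 u \<tau>"
    by (simp add: theta3_def c_def mult_ac)
  ultimately have "((\<lambda>m. theta3_term \<tau> u (m + 1)) has_sum theta3 u \<tau>) UNIV"
    by simp
  then show ?thesis
    by (subst (asm) has_sum_reindex_bij_witness[where i = "\<lambda>m. m - 1" and j = "\<lambda>m. m + 1" and T = UNIV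
          and h = "theta3_term \<tau> u" and s' = "theta3 u \<tau>"]) auto
qed

lemma abs_summable_theta3_term:
  assumes "Im \<tau> > 0"
  shows "(\<lambda>m. norm (theta3_term \<tau> u m)) summable_on UNIV"
proof -
  have "theta3_term \<tau> u m = triple_term \<tau> (u - \<tau> / 2) m" for m
    unfolding triple_term_def theta3_term_def
    by (rule arg_cong[where f = exp]) (simp add: field_simps power2_eq_square)
  then show ?thesis
    using abs_summable_triple_term[OF assms, of "u - \<tau> / 2"] by simp
qed

lemma has_sum_times:
  fixes f :: "'a \<Rightarrow> complex" and g :: "'b \<Rightarrow> complex"
  assumes "(f has_sum a) A" "(g has_sum b) B"
    and "(\<lambda>x. norm (f x)) summable_on A" "(\<lambda>x. norm (g x)) summable_on B"
  shows "((\<lambda>(x, y). f x * g y) has_sum a * b) (A \<times> B)"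
proof (rule has_sum_SigmaI)
  fix x assume "x \<in> A"
  show "((\<lambda>y. case (x, y) of (x, y) \<Rightarrow> f x * g y) has_sum f x * b) B"
    using has_sum_cmult_right[OF assms(2)] by simp
next
  show "((\<lambda>x. f x * b) has_sum a * b) A"
    by (rule has_sum_cmult_left[OF assms(1)])
  have "(\<lambda>xy. norm (case xy of (x, y) \<Rightarrow> f x * g y)) summable_on A \<times> B"
    unfolding Infinite_Sum.abs_summable_on_Sigma_iff using assms(3,4)
    by (auto simp: norm_mult abs_mult infsum_cmult_right' intro!: summable_on_cmult_right summable_on_cmult_left)
  then show "(\<lambda>(x, y). f x * g y) summable_on A \<times> B"
    by (rule abs_summable_summable)
qed

text \<open>In the double series of the left-hand side the terms with \<open>m + n\<close> even cancel. The remaining indices are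
  exactly \<open>(m, n) = (j + l + 1, j - l)\<close> with \<open>j\<close>, \<open>l\<close> integral, and
  \<open>m\<^sup>2 + n\<^sup>2 = 2 (j + 1/2)\<^sup>2 + 2 (l + 1/2)\<^sup>2\<close> matches modulus \<open>\<tau>/2\<close> on the left with modulus \<open>\<tau>\<close> on the right.\<close>

theorem theta_addition:
  assumes "Im \<tau> > 0"
  shows "theta3 x (\<tau> / 2) * theta0 y (\<tau> / 2) - theta0 x (\<tau> / 2) * theta3 y (\<tau> / 2) =
    - 2 * theta1 (x + y) \<tau> * theta1 (x - y) \<tau>"
proof -
  have half: "Im (\<tau> / 2) > 0" using assms by simp
  define p where "p m n = theta3_term (\<tau> / 2) x m * theta3_term (\<tau> / 2) y n" for m n
  define s :: "int \<Rightarrow> complex" where "s m = (-1) powi m" for m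
  define Odd :: "(int \<times> int) set" where "Odd = {(m, n). odd (m + n)}"
  have abs: "(\<lambda>m. norm ((-1) powi m * theta3_term (\<tau> / 2) z m)) summable_on UNIV" for z
    using abs_summable_theta3_term[OF half, of z] by (simp add: norm_mult norm_power_int)
  have "((\<lambda>(m, n). s n * p m n) has_sum theta3 x (\<tau> / 2) * theta0 y (\<tau> / 2)) UNIV"
    using has_sum_times[OF theta3_series[OF half] theta0_series[OF half]
        abs_summable_theta3_term[OF half] abs, of x y]
    by (simp add: s_def p_def mult_ac)
  moreover have "((\<lambda>(m, n). s m * p m n) has_sum theta0 x (\<tau> / 2) * theta3 y (\<tau> / 2)) UNIV"
    using has_sum_times[OF theta0_series[OF half] theta3_series[OF half]
        abs abs_summable_theta3_term[OF half], of x y]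
    by (simp add: s_def p_def mult_ac)
  ultimately have "((\<lambda>mn. (case mn of (m, n) \<Rightarrow> s n * p m n) - (case mn of (m, n) \<Rightarrow> s m * p m n)) has_sum
      theta3 x (\<tau> / 2) * theta0 y (\<tau> / 2) - theta0 x (\<tau> / 2) * theta3 y (\<tau> / 2)) UNIV"
    unfolding diff_conv_add_uminus by (intro has_sum_add has_sum_uminus[THEN iffD2]) simp_all
  moreover have "((\<lambda>mn. (case mn of (m, n) \<Rightarrow> s n * p m n) - (case mn of (m, n) \<Rightarrow> s m * p m n)) has_sum S) UNIV \<longleftrightarrow>
      ((\<lambda>(m, n). - 2 * (s m * p m n)) has_sum S) Odd" for S
    by (rule has_sum_cong_neutral) (auto simp: Odd_def s_def power_int_minus_left split: if_splits)
  ultimately have D: "((\<lambda>(m, n). - 2 * (s m * p m n)) has_sum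
      theta3 x (\<tau> / 2) * theta0 y (\<tau> / 2) - theta0 x (\<tau> / 2) * theta3 y (\<tau> / 2)) Odd"
    by blast
  define t where "t = (\<lambda>(j, l). theta1_term \<tau> (x + y) j * theta1_term \<tau> (x - y) l)"
  have "(t has_sum (\<i> * theta1 (x + y) \<tau>) * (\<i> * theta1 (x - y) \<tau>)) UNIV"
    using has_sum_times[OF theta1_series[OF assms] theta1_series[OF assms]
        abs_summable_theta1_term[OF assms] abs_summable_theta1_term[OF assms], of "x + y" "x - y"]
    by (simp add: t_def)
  then have "((\<lambda>jl. 2 * t jl) has_sum 2 * ((\<i> * theta1 (x + y) \<tau>) * (\<i> * theta1 (x - y) \<tau>))) UNIV"
    by (rule has_sum_cmult_right)
  moreover have "((\<lambda>jl. 2 * t jl) has_sum S) UNIV \<longleftrightarrow> ((\<lambda>(m, n). - 2 * (s m * p m n)) has_sum S) Odd" for S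
  proof (rule has_sum_reindex_bij_witness
      [where i = "\<lambda>(m, n). ((m + n - 1) div 2, (m - n - 1) div 2)" and j = "\<lambda>(j, l). (j + l + 1, j - l)"])
    fix jl :: "int \<times> int"
    obtain j l where jl: "jl = (j, l)" by (cases jl)
    have "s (j + l + 1) * p (j + l + 1) (j - l) = - (theta1_term \<tau> (x + y) j * theta1_term \<tau> (x - y) l)"
    proof -
      have "s (j + l + 1) = - (s j * s l)"
        by (simp add: s_def power_int_add)
      moreover have "p (j + l + 1) (j - l) =
          exp (of_real pi * \<i> * ((of_int j + 1 / 2)\<^sup>2 * \<tau> + (2 * of_int j + 1) * (x + y))) *
          exp (of_real pi * \<i> * ((of_int l + 1 / 2)\<^sup>2 * \<tau> + (2 * of_int l + 1) * (x - y)))"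
        unfolding p_def theta3_term_def exp_add[symmetric]
        by (rule arg_cong[where f = exp]) (simp add: field_simps power2_eq_square)
      ultimately show ?thesis by (simp add: theta1_term_def s_def mult_ac)
    qed
    then show "(case case jl of (j, l) \<Rightarrow> (j + l + 1, j - l) of (m, n) \<Rightarrow> - 2 * (s m * p m n)) = 2 * t jl"
      by (simp add: jl t_def)
  qed (auto simp: Odd_def, presburger+)
  ultimately have "((\<lambda>(m, n). - 2 * (s m * p m n)) has_sum
      2 * ((\<i> * theta1 (x + y) \<tau>) * (\<i> * theta1 (x - y) \<tau>))) Odd"
    by blast
  from has_sum_unique[OF D this] show ?thesis by (simp add: algebra_simps)
qed

text \<open>By the addition formula each \<open>t x y\<close> is, up to the factor \<open>-1/2\<close>, the determinant of the vectors
  \<open>(\<theta>\<^sub>3, \<theta>\<^sub>0)\<close> at \<open>x\<close> and \<open>y\<close>; four vectors in a plane satisfy the Pluecker relation.\<close>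

lemma theta1_three_term:
  assumes "Im \<tau> > 0"
  defines "t \<equiv> \<lambda>x y. theta1 (x + y) \<tau> * theta1 (x - y) \<tau>"
  shows "t x a * t b c = t x b * t a c + t x c * t b a"
proof -
  define f g where "f z = theta3 z (\<tau> / 2)" and "g z = theta0 z (\<tau> / 2)" for z
  have t: "t x y = - (f x * g y - g x * f y) / 2" for x y
    using theta_addition[OF assms(1), of x y] by (simp add: t_def f_def g_def)
  show ?thesis unfolding t by (simp add: field_simps)
qed

section \<open>Elliptic numbers and the Pascal recursion of elliptic binomial coefficients\<close>

lemma Cnorm_nonzero: "Im \<tau> > 0 \<Longrightarrow> Cnorm r \<tau> \<noteq> 0"
  by (auto simp: Cnorm_def xpow_def)

lemma br_minus: "br r \<tau> (- u) = - br r \<tau> u"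
  by (simp add: br_def theta1_minus)

lemma br_eq_0_imp_period: "Im \<tau> > 0 \<Longrightarrow> br r \<tau> u = 0 \<Longrightarrow> u / r \<in> period_lattice \<tau>"
  by (auto simp: br_def Cnorm_nonzero intro: theta1_eq_0_imp_period)

lemma br_three_term:
  fixes r \<tau> :: complex
  assumes "Im \<tau> > 0"
  defines "t \<equiv> \<lambda>x y. br r \<tau> (x + y) * br r \<tau> (x - y)"
  shows "t x a * t b c = t x b * t a c + t x c * t b a"
  using arg_cong[OF theta1_three_term[OF assms(1), of "x / r" "a / r" "b / r" "c / r"], of "\<lambda>z. Cnorm r \<tau> ^ 4 * z"]
  by (simp add: t_def br_def add_divide_distrib diff_divide_distrib algebra_simps power4_eq_xxxx)

lemma brp_0 [simp]: "brp r \<tau> u 0 = 1"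
  by (simp add: brp_def)

lemma brp_Suc: "brp r \<tau> u (Suc n) = brp r \<tau> u n * br r \<tau> (u + of_nat n)"
  by (simp add: brp_def)

lemma brp_Suc_left: "brp r \<tau> u (Suc n) = br r \<tau> u * brp r \<tau> (u + 1) n"
  unfolding brp_def by (subst prod.lessThan_Suc_shift) (simp add: add_ac)

text \<open>The weights of the \<open>(k + 1)\<close>-st step of a path that has made \<open>n\<close> up-steps among its first \<open>k\<close>, in the
  parameters of the binomial coefficients: up in \<open>weight_up\<close>, down in \<open>weight_down\<close>.\<close>

definition weight_up :: "complex \<Rightarrow> complex \<Rightarrow> nat \<Rightarrow> nat \<Rightarrow> complex \<Rightarrow> complex \<Rightarrow> complex \<Rightarrow> complex" where
  "weight_up r \<tau> k n \<alpha> \<beta> \<gamma> =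
     br r \<tau> (\<alpha> - \<gamma> + of_nat n) * br r \<tau> (\<alpha> + \<gamma> + 2 * of_nat k - of_nat n) /
     (br r \<tau> (\<beta> - \<gamma> - of_nat k + 2 * of_nat n) * br r \<tau> (\<beta> + \<gamma> + of_nat k))"

definition weight_down :: "complex \<Rightarrow> complex \<Rightarrow> nat \<Rightarrow> nat \<Rightarrow> complex \<Rightarrow> complex \<Rightarrow> complex \<Rightarrow> complex" where
  "weight_down r \<tau> k n \<alpha> \<beta> \<gamma> =
     br r \<tau> (\<alpha> + \<beta> + of_nat n + of_nat k) * br r \<tau> (\<alpha> - \<beta> + of_nat k - of_nat n) /
     (br r \<tau> (\<gamma> - \<beta> + of_nat k - 2 * of_nat n) * br r \<tau> (\<beta> + \<gamma> + of_nat k))"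

lemma ell_binom_0_0: "ell_binom r \<tau> 0 0 \<alpha> \<beta> \<gamma> = 1"
  by (simp add: ell_binom_def)

lemma brp_1_nonzero:
  assumes "\<And>j. 1 \<le> j \<Longrightarrow> j \<le> k \<Longrightarrow> br r \<tau> (of_nat j) \<noteq> 0"
  shows "brp r \<tau> 1 k \<noteq> 0"
  unfolding brp_def using assms[of "Suc _"] by (auto simp: add_ac)

text \<open>On the boundary of Pascal's triangle only one of the two steps contributes and the coefficients are plain
  products.\<close>

lemma ell_binom_Suc_0:
  assumes "\<And>j. 1 \<le> j \<Longrightarrow> j \<le> Suc k \<Longrightarrow> br r \<tau> (of_nat j) \<noteq> 0"
  shows "ell_binom r \<tau> (Suc k) 0 \<alpha> \<beta> \<gamma> = ell_binom r \<tau> k 0 \<alpha> \<beta> \<gamma> * weight_down r \<tau> k 0 \<alpha> \<beta> \<gamma>"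
proof -
  have "brp r \<tau> 1 k \<noteq> 0" "brp r \<tau> 1 (Suc k) \<noteq> 0"
    using assms by (auto intro!: brp_1_nonzero simp del: of_nat_Suc)
  then show ?thesis
    unfolding ell_binom_def weight_down_def
    by (simp add: brp_Suc mult_ac add_ac)
qed

lemma ell_binom_Suc_Suc_same:
  assumes "\<And>j. 1 \<le> j \<Longrightarrow> j \<le> Suc k \<Longrightarrow> br r \<tau> (of_nat j) \<noteq> 0"
  shows "ell_binom r \<tau> (Suc k) (Suc k) \<alpha> \<beta> \<gamma> = ell_binom r \<tau> k k \<alpha> \<beta> \<gamma> * weight_up r \<tau> k k \<alpha> \<beta> \<gamma>"
proof -
  have "brp r \<tau> 1 k \<noteq> 0" "brp r \<tau> 1 (Suc k) \<noteq> 0"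
    using assms by (auto intro!: brp_1_nonzero simp del: of_nat_Suc)
  then show ?thesis
    unfolding ell_binom_def weight_up_def
    by (simp add: brp_Suc mult_ac add_ac)
qed

text \<open>All three terms share the factor \<open>Q\<close> of the proof. What remains after its removal is \<open>br_three_term\<close>
  at \<open>x = \<alpha> + (\<beta> + \<gamma>)/2 + k\<close> with \<open>d = (\<beta> - \<gamma>)/2\<close>, \<open>d + m + 1\<close> and
  \<open>d + m - k\<close> as the other three arguments.\<close>

lemma ell_binom_Suc_Suc:
  assumes "Im \<tau> > 0" and k: "k = Suc (m + l)"
    and nz: "br r \<tau> (\<beta> - \<gamma> - of_nat l - 1) \<noteq> 0" "br r \<tau> (\<beta> - \<gamma> + of_nat m - of_nat l) \<noteq> 0"
      "br r \<tau> (\<beta> - \<gamma> + of_nat m + 1) \<noteq> 0" "br r \<tau> (of_nat (Suc m)) \<noteq> 0" "br r \<tau> (of_nat (Suc l)) \<noteq> 0"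
  shows "ell_binom r \<tau> (Suc k) (Suc m) \<alpha> \<beta> \<gamma> =
    ell_binom r \<tau> k m \<alpha> \<beta> \<gamma> * weight_up r \<tau> k m \<alpha> \<beta> \<gamma> +
    ell_binom r \<tau> k (Suc m) \<alpha> \<beta> \<gamma> * weight_down r \<tau> k (Suc m) \<alpha> \<beta> \<gamma>"
proof -
  define e where "e = br r \<tau>"
  define p where "p = brp r \<tau>"
  note [simp] = e_def[symmetric] p_def[symmetric]
  note p_Suc = brp_Suc[of r \<tau>, folded e_def p_def]
  note p_left = brp_Suc_left[of r \<tau>, folded e_def p_def]
  define G0 GL H0 where "G0 = e (\<beta> - \<gamma> - of_nat l - 1)" and "GL = e (\<beta> - \<gamma> + of_nat m - of_nat l)"
    and "H0 = e (\<gamma> - \<beta> - of_nat m - 1)"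
  define M1 L1 where "M1 = e (of_nat m + 1)" and "L1 = e (of_nat l + 1)"
  define U V where "U = e (\<alpha> + \<gamma> + 2 * of_nat k - of_nat m)" and "V = e (\<alpha> + \<beta> + of_nat m + 1 + of_nat k)"
  define B0 BL F0 FL K1 where "B0 = e (\<alpha> + \<gamma> + of_nat l)" and "BL = e (\<alpha> + \<gamma> + of_nat k)"
    and "F0 = e (\<alpha> + \<beta> + of_nat m)" and "FL = e (\<alpha> + \<beta> + of_nat k)" and "K1 = e (of_nat k + 1)"
  have H0: "H0 = - e (\<beta> - \<gamma> + of_nat m + 1)"
    unfolding H0_def e_def br_minus[symmetric] by (simp add: algebra_simps)
  have HL: "e (\<gamma> - \<beta> - of_nat m + of_nat l) = - GL"
    unfolding GL_def e_def br_minus[symmetric] by (simp add: algebra_simps)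
  have nz': "G0 \<noteq> 0" "GL \<noteq> 0" "H0 \<noteq> 0" "M1 \<noteq> 0" "L1 \<noteq> 0"
    using nz unfolding G0_def GL_def H0 M1_def L1_def e_def by (simp_all add: add_ac)
  have kc: "(of_nat k :: complex) = of_nat m + of_nat l + 1" by (simp add: k)
  \<comment> \<open>What is left of the recursion after division by \<open>Q\<close> and multiplication by all denominators.\<close>
  have key: "K1 * BL * FL * GL = - (M1 * F0 * U * H0) + L1 * B0 * V * G0"
  proof -
    define x where "x = \<alpha> + (\<beta> + \<gamma>) / 2 + of_nat k"
    define d where "d = (\<beta> - \<gamma>) / 2"
    have "(e (x + d) * e (x - d)) * (e ((d + of_nat m + 1) + (d + of_nat m - of_nat k)) * e ((d + of_nat m + 1) - (d + of_nat m - of_nat k)))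
      = (e (x + (d + of_nat m + 1)) * e (x - (d + of_nat m + 1))) * (e (d + (d + of_nat m - of_nat k)) * e (d - (d + of_nat m - of_nat k)))
      + (e (x + (d + of_nat m - of_nat k)) * e (x - (d + of_nat m - of_nat k))) * (e ((d + of_nat m + 1) + d) * e ((d + of_nat m + 1) - d))"
      unfolding e_def by (rule br_three_term[OF assms(1)])
    moreover have "x + d = \<alpha> + \<beta> + of_nat k" "x - d = \<alpha> + \<gamma> + of_nat k"
      "(d + of_nat m + 1) + (d + of_nat m - of_nat k) = \<beta> - \<gamma> + of_nat m - of_nat l"
      "(d + of_nat m + 1) - (d + of_nat m - of_nat k) = of_nat k + 1"
      "x + (d + of_nat m + 1) = \<alpha> + \<beta> + of_nat m + 1 + of_nat k"
      "x - (d + of_nat m + 1) = \<alpha> + \<gamma> + of_nat l"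
      "d + (d + of_nat m - of_nat k) = \<beta> - \<gamma> - of_nat l - 1"
      "d - (d + of_nat m - of_nat k) = of_nat l + 1"
      "x + (d + of_nat m - of_nat k) = \<alpha> + \<beta> + of_nat m"
      "x - (d + of_nat m - of_nat k) = \<alpha> + \<gamma> + 2 * of_nat k - of_nat m"
      "(d + of_nat m + 1) + d = \<beta> - \<gamma> + of_nat m + 1"
      "(d + of_nat m + 1) - d = of_nat m + 1"
      unfolding x_def d_def kc by (simp_all add: field_simps)
    ultimately show ?thesis
      unfolding H0 K1_def BL_def FL_def GL_def M1_def F0_def U_def L1_def B0_def V_def G0_def
      by (simp only:) (simp add: algebra_simps)
  qed
  define Q where "Q = p 1 k * p (\<alpha> - \<gamma>) (Suc m) * p (\<alpha> + \<gamma> + of_nat l + 1) m * p (\<alpha> - \<beta>) (Suc l) *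
      p (\<alpha> + \<beta> + of_nat m + 1) l /
      (p 1 m * p 1 l * p (\<beta> - \<gamma> - of_nat l) m * p (\<gamma> - \<beta> - of_nat m) l * p (\<beta> + \<gamma>) (Suc k))"
  have lhs: "ell_binom r \<tau> (Suc k) (Suc m) \<alpha> \<beta> \<gamma> = Q * (K1 * BL * FL / (M1 * L1 * G0 * H0))"
  proof -
    have d: "Suc k - Suc m = Suc l" by (simp add: k)
    have "p (\<alpha> + \<gamma> + of_nat (Suc k) - of_nat (Suc m)) (Suc m) = p (\<alpha> + \<gamma> + of_nat l + 1) m * BL"
      unfolding p_Suc BL_def kc by (simp add: kc add_ac)
    moreover have "p (\<alpha> + \<beta> + of_nat (Suc m)) (Suc l) = p (\<alpha> + \<beta> + of_nat m + 1) l * FL"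
      unfolding p_Suc FL_def kc by (simp add: add_ac)
    moreover have "p (\<beta> - \<gamma> + of_nat (Suc m) - of_nat (Suc k)) (Suc m) = G0 * p (\<beta> - \<gamma> - of_nat l) m"
      unfolding p_left G0_def by (simp add: kc algebra_simps)
    moreover have "p (\<gamma> - \<beta> - of_nat (Suc m)) (Suc l) = H0 * p (\<gamma> - \<beta> - of_nat m) l"
      unfolding p_left H0_def by (simp add: algebra_simps)
    moreover have "p 1 (Suc k) = p 1 k * K1" "p 1 (Suc m) = p 1 m * M1" "p 1 (Suc l) = p 1 l * L1"
      unfolding p_Suc K1_def M1_def L1_def by (simp_all add: add_ac)
    ultimately show ?thesis
      unfolding ell_binom_def d p_def[symmetric] e_def[symmetric] Q_def
      by (simp only: divide_inverse inverse_mult_distrib mult_ac)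
  qed
  have t1: "ell_binom r \<tau> k m \<alpha> \<beta> \<gamma> * weight_up r \<tau> k m \<alpha> \<beta> \<gamma> = Q * (F0 * U / (L1 * G0 * (- GL)))"
  proof -
    have d: "k - m = Suc l" by (simp add: k)
    have A: "p (\<alpha> - \<gamma>) (Suc m) = p (\<alpha> - \<gamma>) m * e (\<alpha> - \<gamma> + of_nat m)"
      by (rule p_Suc)
    have B: "\<alpha> + \<gamma> + of_nat k - of_nat m = \<alpha> + \<gamma> + of_nat l + 1"
      by (simp add: kc)
    have F: "p (\<alpha> + \<beta> + of_nat m) (Suc l) = F0 * p (\<alpha> + \<beta> + of_nat m + 1) l"
      unfolding p_left F0_def ..
    have "p (\<beta> - \<gamma> - of_nat l - 1) (Suc m) = G0 * p (\<beta> - \<gamma> - of_nat l) m"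
      unfolding p_left G0_def by simp
    then have G: "p (\<beta> - \<gamma> + of_nat m - of_nat k) m * e (\<beta> - \<gamma> - of_nat k + 2 * of_nat m) = G0 * p (\<beta> - \<gamma> - of_nat l) m"
      unfolding p_Suc by (simp add: kc algebra_simps)
    have H: "p (\<gamma> - \<beta> - of_nat m) (Suc l) = p (\<gamma> - \<beta> - of_nat m) l * (- GL)"
      unfolding p_Suc HL ..
    have L: "p 1 (Suc l) = p 1 l * L1"
      unfolding p_Suc L1_def by (simp add: add_ac)
    have Z: "p (\<beta> + \<gamma>) (Suc k) = p (\<beta> + \<gamma>) k * e (\<beta> + \<gamma> + of_nat k)"
      by (rule p_Suc)
    have "ell_binom r \<tau> k m \<alpha> \<beta> \<gamma> * weight_up r \<tau> k m \<alpha> \<beta> \<gamma> =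
       p 1 k * p (\<alpha> - \<gamma>) (Suc m) * p (\<alpha> + \<gamma> + of_nat l + 1) m * p (\<alpha> - \<beta>) (Suc l) * (F0 * p (\<alpha> + \<beta> + of_nat m + 1) l) * U /
       (p 1 m * (p 1 l * L1) * (p (\<beta> - \<gamma> + of_nat m - of_nat k) m * e (\<beta> - \<gamma> - of_nat k + 2 * of_nat m)) *
        (p (\<gamma> - \<beta> - of_nat m) l * (- GL)) * p (\<beta> + \<gamma>) (Suc k))"
      unfolding ell_binom_def weight_up_def d p_def[symmetric] e_def[symmetric] U_def[symmetric] B A F H L Z
      by (simp only: divide_inverse inverse_mult_distrib mult_ac)
    then show ?thesis
      unfolding G Q_def by (simp only: divide_inverse inverse_mult_distrib mult_ac)
  qed
  have t2: "ell_binom r \<tau> k (Suc m) \<alpha> \<beta> \<gamma> * weight_down r \<tau> k (Suc m) \<alpha> \<beta> \<gamma> = Q * (B0 * V / (M1 * GL * H0))"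
  proof -
    have d: "k - Suc m = l" by (simp add: k)
    have E: "p (\<alpha> - \<beta>) (Suc l) = p (\<alpha> - \<beta>) l * e (\<alpha> - \<beta> + of_nat k - of_nat (Suc m))"
      unfolding p_Suc by (simp add: kc algebra_simps)
    have B_arg: "\<alpha> + \<gamma> + of_nat k - of_nat (Suc m) = \<alpha> + \<gamma> + of_nat l"
      by (simp add: kc)
    have B: "p (\<alpha> + \<gamma> + of_nat k - of_nat (Suc m)) (Suc m) = B0 * p (\<alpha> + \<gamma> + of_nat l + 1) m"
      unfolding B_arg p_left B0_def ..
    have F: "\<alpha> + \<beta> + of_nat (Suc m) = \<alpha> + \<beta> + of_nat m + 1"
      by simp
    have G_arg: "\<beta> - \<gamma> + of_nat (Suc m) - of_nat k = \<beta> - \<gamma> - of_nat l"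
      by (simp add: kc)
    have G: "p (\<beta> - \<gamma> + of_nat (Suc m) - of_nat k) (Suc m) = p (\<beta> - \<gamma> - of_nat l) m * GL"
      unfolding G_arg p_Suc GL_def by (simp add: algebra_simps)
    have "p (\<gamma> - \<beta> - of_nat (Suc m)) (Suc l) = H0 * p (\<gamma> - \<beta> - of_nat m) l"
      unfolding p_left H0_def by (simp add: algebra_simps)
    then have H: "p (\<gamma> - \<beta> - of_nat (Suc m)) l * e (\<gamma> - \<beta> + of_nat k - 2 * of_nat (Suc m)) = H0 * p (\<gamma> - \<beta> - of_nat m) l"
      unfolding p_Suc by (simp add: kc algebra_simps)
    have M: "p 1 (Suc m) = p 1 m * M1"
      unfolding p_Suc M1_def by (simp add: add_ac)
    have Z: "p (\<beta> + \<gamma>) (Suc k) = p (\<beta> + \<gamma>) k * e (\<beta> + \<gamma> + of_nat k)"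
      by (rule p_Suc)
    have "ell_binom r \<tau> k (Suc m) \<alpha> \<beta> \<gamma> * weight_down r \<tau> k (Suc m) \<alpha> \<beta> \<gamma> =
       p 1 k * p (\<alpha> - \<gamma>) (Suc m) * (B0 * p (\<alpha> + \<gamma> + of_nat l + 1) m) * p (\<alpha> - \<beta>) (Suc l) * p (\<alpha> + \<beta> + of_nat m + 1) l * V /
       ((p 1 m * M1) * p 1 l * (p (\<beta> - \<gamma> - of_nat l) m * GL) *
        (p (\<gamma> - \<beta> - of_nat (Suc m)) l * e (\<gamma> - \<beta> + of_nat k - 2 * of_nat (Suc m))) * p (\<beta> + \<gamma>) (Suc k))"
      unfolding ell_binom_def weight_down_def d p_def[symmetric] e_def[symmetric] F V_def[symmetric] B E G M Z
      by (simp only: divide_inverse inverse_mult_distrib mult_ac)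
    then show ?thesis
      unfolding H Q_def by (simp only: divide_inverse inverse_mult_distrib mult_ac)
  qed
  have "K1 * BL * FL / (M1 * L1 * G0 * H0) = F0 * U / (L1 * G0 * (- GL)) + B0 * V / (M1 * GL * H0)"
  proof -
    have "K1 * BL * FL / (M1 * L1 * G0 * H0) = (K1 * BL * FL * GL) / (M1 * L1 * G0 * H0 * GL)"
      using nz' by simp
    also have "\<dots> = F0 * U / (L1 * G0 * (- GL)) + B0 * V / (M1 * GL * H0)"
      unfolding key using nz' by (simp add: field_simps)
    finally show ?thesis .
  qed
  then show ?thesis unfolding lhs t1 t2 by (simp only: distrib_left)
qed

section \<open>Weighted sums over height paths\<close>

definition path_sum :: "(nat \<Rightarrow> int \<Rightarrow> int \<Rightarrow> complex) \<Rightarrow> nat \<Rightarrow> int \<Rightarrow> int \<Rightarrow> complex" where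
  "path_sum w k a b = (\<Sum>h\<in>height_paths k a b. \<Prod>i<k. w i (h i) (h (Suc i)))"

lemma path_sum_0: "path_sum w 0 a b = (if a = b then 1 else 0)"
proof -
  have "height_paths 0 a b = (if a = b then {\<lambda>i\<in>{..0}. a} else {})"
    by (auto simp: height_paths_def PiE_def extensional_def restrict_def fun_eq_iff)
  then show ?thesis by (simp add: path_sum_def)
qed

text \<open>The height before the last step is \<open>b - 1\<close> or \<open>b + 1\<close>.\<close>

lemma path_sum_Suc:
  "path_sum w (Suc k) a b = path_sum w k a (b - 1) * w k (b - 1) b + path_sum w k a (b + 1) * w k (b + 1) b"
proof -
  have "path_sum w (Suc k) a b =
      (\<Sum>(d, h)\<in>(SIGMA d:{b - 1, b + 1}. height_paths k a d). (\<Prod>i<k. w i (h i) (h (Suc i))) * w k d b)"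
    unfolding path_sum_def
  proof (rule sum.reindex_bij_witness
      [of _ "\<lambda>(d, h). h(Suc k := b)" "\<lambda>h. (h k, h(Suc k := undefined))"], goal_cases)
    case (1 h)
    then show ?case by (auto simp: height_paths_def)
  next
    case (2 h)
    then have steps: "\<And>i. i < Suc k \<Longrightarrow> \<bar>h i - h (Suc i)\<bar> = 1"
      and ends: "h 0 = a" "h (Suc k) = b" and ext: "\<And>i. i > Suc k \<Longrightarrow> h i = undefined"
      by (auto simp: height_paths_def PiE_def extensional_def)
    have "\<bar>h k - b\<bar> = 1" using steps[of k] ends by simp
    then have "h k = b - 1 \<or> h k = b + 1" by linarith
    then show ?case
      using steps ends ext by (auto simp: height_paths_def PiE_def extensional_def)
  next
    case (3 dh)
    then show ?case
      by (auto simp: height_paths_def PiE_def extensional_def fun_eq_iff)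
  next
    case (4 dh)
    then show ?case
      by (auto simp: height_paths_def PiE_def extensional_def less_Suc_eq)
  next
    case (5 h)
    then show ?case
      by (auto simp: height_paths_def)
  qed
  also have "\<dots> = (\<Sum>d\<in>{b - 1, b + 1}. path_sum w k a d * w k d b)"
    by (subst sum.Sigma[symmetric]) (simp_all add: finite_height_paths path_sum_def sum_distrib_right)
  finally show ?thesis by simp
qed

lemma path_sum_eq_0: "\<bar>b - a\<bar> > int k \<Longrightarrow> path_sum w k a b = 0"
  by (induction k arbitrary: b) (auto simp: path_sum_0 path_sum_Suc)

lemma path_sum_cong:
  "(\<And>i x y. i < k \<Longrightarrow> w i x y = w' i x y) \<Longrightarrow> path_sum w k a b = path_sum w' k a b"
  unfolding path_sum_def by (intro sum.cong prod.cong) auto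

section \<open>Step weights and their path sums\<close>

text \<open>Writing out the two signs gives the determinant of \<open>theta_addition\<close> at the points \<open>x\<close> and \<open>y\<close> of the proof.\<close>

lemma psi_pairing:
  fixes A h \<sigma> :: int
  assumes "Im \<tau> > 0" "r \<noteq> 0" "\<sigma> = 1 \<or> \<sigma> = - 1"
  shows "(\<Sum>\<epsilon>\<in>{1, - 1}. psi_star r \<tau> \<epsilon> v (h + \<sigma>) h * psi r \<tau> \<epsilon> v A (A + 1)) =
    of_int \<sigma> * br r \<tau> ((of_int \<sigma> * v + of_int h + of_int A - v) / 2) *
      br r \<tau> ((of_int \<sigma> * v + of_int h - of_int A + v) / 2) / (br r \<tau> (of_int h) * br r \<tau> v)"
proof -
  define x y where "x = (of_int \<sigma> * v + of_int h) / (2 * r)" and "y = (of_int A - v) / (2 * r)"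
  define K where "K = - of_int \<sigma> * (Cnorm r \<tau>)\<^sup>2 / (2 * (br r \<tau> (of_int h) * br r \<tau> v))"
  have arg: "(of_int (h + \<sigma> - h) * (v - 1) + of_int (h + \<sigma>)) / (2 * r) = x"
    "(of_int (A - (A + 1)) * v + of_int A) / (2 * r) = y"
    by (simp_all add: x_def y_def algebra_simps)
  have "(\<Sum>\<epsilon>\<in>{1, - 1}. psi_star r \<tau> \<epsilon> v (h + \<sigma>) h * psi r \<tau> \<epsilon> v A (A + 1)) =
      K * (theta3 x (\<tau> / 2) * theta0 y (\<tau> / 2) - theta0 x (\<tau> / 2) * theta3 y (\<tau> / 2))"
    unfolding psi_star_def psi_def arg
    by (simp add: K_def algebra_simps diff_divide_distrib)
  also have "\<dots> = of_int \<sigma> * (Cnorm r \<tau> * theta1 (x + y) \<tau>) * (Cnorm r \<tau> * theta1 (x - y) \<tau>) /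
      (br r \<tau> (of_int h) * br r \<tau> v)"
    unfolding theta_addition[OF assms(1)] by (simp add: K_def field_simps power2_eq_square)
  also have "x + y = (of_int \<sigma> * v + of_int h + of_int A - v) / 2 / r"
    using assms(2) by (simp add: x_def y_def field_simps)
  also have "x - y = (of_int \<sigma> * v + of_int h - of_int A + v) / 2 / r"
    using assms(2) by (simp add: x_def y_def field_simps)
  finally show ?thesis unfolding br_def .
qed

text \<open>The hypotheses on \<open>w\<close> are the values that \<open>psi_pairing\<close> gives for the step weights, with \<open>v\<close> the spectral
  parameter of the first step. As \<open>v\<close> stays fixed, so do \<open>\<alpha>\<close>, \<open>\<beta>\<close>, \<open>\<gamma>\<close>, and induction on \<open>k\<close> is possible.\<close>

lemma path_sum_eq_ell_binom:
  fixes \<tau> r \<alpha> \<beta> \<gamma> a v :: complex and b :: int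
  assumes "Im \<tau> > 0"
    and params: "\<alpha> = (a - v) / 2" "\<beta> = (of_int b - v) / 2" "\<gamma> = (- of_int b - v) / 2"
    and up: "\<And>i h. w i h (h + 1) = br r \<tau> ((of_int h + a + of_nat i) / 2) *
        br r \<tau> ((of_int h - a - of_nat i) / 2 + (v - of_nat i)) / (br r \<tau> (of_int h) * br r \<tau> (v - of_nat i))"
    and down: "\<And>i h. w i h (h - 1) = - br r \<tau> ((of_int h + a + of_nat i) / 2 - (v - of_nat i)) *
        br r \<tau> ((of_int h - a - of_nat i) / 2) / (br r \<tau> (of_int h) * br r \<tau> (v - of_nat i))"
    and nz_b: "\<And>j. \<bar>j\<bar> < int k \<Longrightarrow> br r \<tau> (of_int (b + j)) \<noteq> 0"
    and nz_1: "\<And>j. 1 \<le> j \<Longrightarrow> j \<le> k \<Longrightarrow> br r \<tau> (of_nat j) \<noteq> 0"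
    and n: "n \<le> k"
  shows "path_sum w k b (b - int k + 2 * int n) = ell_binom r \<tau> k n \<alpha> \<beta> \<gamma>"
proof -
  define e where "e = br r \<tau>"
  have minus: "e (- z) = - e z" for z by (simp add: e_def br_minus)
  have b: "of_int b = \<beta> - \<gamma>" and v: "v = - (\<beta> + \<gamma>)" and a: "a = 2 * \<alpha> - \<beta> - \<gamma>"
    unfolding params by (simp_all add: field_simps)
  have W_up: "w k h (h + 1) = weight_up r \<tau> k n \<alpha> \<beta> \<gamma>" if h: "h = b - int k + 2 * int n" for k n h
  proof -
    have "(of_int h + a + of_nat k) / 2 = \<alpha> - \<gamma> + of_nat n"
      "(of_int h - a - of_nat k) / 2 + (v - of_nat k) = - (\<alpha> + \<gamma> + 2 * of_nat k - of_nat n)"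
      "of_int h = \<beta> - \<gamma> - of_nat k + 2 * of_nat n"
      "v - of_nat k = - (\<beta> + \<gamma> + of_nat k)"
      unfolding h by (simp_all add: b a v field_simps)
    then show ?thesis
      unfolding up weight_up_def e_def[symmetric] by (simp only: minus) simp
  qed
  have W_down: "w k h (h - 1) = weight_down r \<tau> k n \<alpha> \<beta> \<gamma>" if h: "h = b - int k + 2 * int n" for k n h
  proof -
    have "(of_int h + a + of_nat k) / 2 - (v - of_nat k) = \<alpha> + \<beta> + of_nat n + of_nat k"
      "(of_int h - a - of_nat k) / 2 = - (\<alpha> - \<beta> + of_nat k - of_nat n)"
      "of_int h = - (\<gamma> - \<beta> + of_nat k - 2 * of_nat n)"
      "v - of_nat k = - (\<beta> + \<gamma> + of_nat k)"
      unfolding h by (simp_all add: b a v field_simps)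
    then show ?thesis
      unfolding down weight_down_def e_def[symmetric] by (simp only: minus) simp
  qed
  show ?thesis
    using nz_b nz_1 n
  proof (induction k arbitrary: n)
    case 0
    then show ?case by (simp add: path_sum_0 ell_binom_0_0)
  next
    case (Suc k)
    have IH: "path_sum w k b (b - int k + 2 * int n') = ell_binom r \<tau> k n' \<alpha> \<beta> \<gamma>" if "n' \<le> k" for n'
      by (rule Suc.IH) (use Suc.prems that in auto)
    have nz1: "br r \<tau> (of_nat j) \<noteq> 0" if "1 \<le> j" "j \<le> Suc k" for j
      using Suc.prems(2) that by blast
    define c where "c = b - int (Suc k) + 2 * int n"
    have rec: "path_sum w (Suc k) b c = path_sum w k b (c - 1) * w k (c - 1) c + path_sum w k b (c + 1) * w k (c + 1) c"
      by (rule path_sum_Suc)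
    have from_below: "path_sum w k b (c - 1) * w k (c - 1) c =
        ell_binom r \<tau> k m \<alpha> \<beta> \<gamma> * weight_up r \<tau> k m \<alpha> \<beta> \<gamma>" if "n = Suc m" for m
    proof -
      have c: "c - 1 = b - int k + 2 * int m" using that by (simp add: c_def)
      have "w k (c - 1) c = weight_up r \<tau> k m \<alpha> \<beta> \<gamma>"
        using W_up[OF c] by simp
      moreover have "path_sum w k b (c - 1) = ell_binom r \<tau> k m \<alpha> \<beta> \<gamma>"
        unfolding c using Suc.prems(3) that by (intro IH) simp
      ultimately show ?thesis by simp
    qed
    have from_above: "path_sum w k b (c + 1) * w k (c + 1) c =
        ell_binom r \<tau> k n \<alpha> \<beta> \<gamma> * weight_down r \<tau> k n \<alpha> \<beta> \<gamma>" if "n \<le> k"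
    proof -
      have c: "c + 1 = b - int k + 2 * int n" by (simp add: c_def)
      have "w k (c + 1) c = weight_down r \<tau> k n \<alpha> \<beta> \<gamma>"
        using W_down[OF c] by simp
      moreover have "path_sum w k b (c + 1) = ell_binom r \<tau> k n \<alpha> \<beta> \<gamma>"
        unfolding c by (rule IH[OF that])
      ultimately show ?thesis by simp
    qed
    consider "n = 0" | "n = Suc k" | m where "n = Suc m" "n \<le> k"
      using Suc.prems(3) by (metis le_SucE not0_implies_Suc)
    then have "path_sum w (Suc k) b c = ell_binom r \<tau> (Suc k) n \<alpha> \<beta> \<gamma>"
    proof cases
      case 1
      then have "path_sum w k b (c - 1) = 0"
        by (intro path_sum_eq_0) (simp add: c_def)
      with 1 show ?thesis unfolding rec using from_above ell_binom_Suc_0[OF nz1] by simp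
    next
      case 2
      then have "path_sum w k b (c + 1) = 0"
        by (intro path_sum_eq_0) (simp add: c_def)
      with 2 show ?thesis unfolding rec using from_below[of k] ell_binom_Suc_Suc_same[OF nz1] by simp
    next
      case 3
      then obtain l where k: "k = Suc (m + l)" by (metis Suc_le_D add_Suc le_Suc_ex)
      have nzb: "br r \<tau> (\<beta> - \<gamma> + of_int j) \<noteq> 0" if "\<bar>j\<bar> \<le> int k" for j
        using Suc.prems(1)[of j] that by (simp add: b)
      have "ell_binom r \<tau> (Suc k) (Suc m) \<alpha> \<beta> \<gamma> =
          ell_binom r \<tau> k m \<alpha> \<beta> \<gamma> * weight_up r \<tau> k m \<alpha> \<beta> \<gamma> +
          ell_binom r \<tau> k (Suc m) \<alpha> \<beta> \<gamma> * weight_down r \<tau> k (Suc m) \<alpha> \<beta> \<gamma>"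
      proof (rule ell_binom_Suc_Suc[OF assms(1) k])
        show "br r \<tau> (\<beta> - \<gamma> - of_nat l - 1) \<noteq> 0"
          using nzb[of "- int l - 1"] by (simp add: k algebra_simps)
        show "br r \<tau> (\<beta> - \<gamma> + of_nat m - of_nat l) \<noteq> 0"
          using nzb[of "int m - int l"] by (simp add: k algebra_simps)
        show "br r \<tau> (\<beta> - \<gamma> + of_nat m + 1) \<noteq> 0"
          using nzb[of "int m + 1"] by (simp add: k algebra_simps)
        show "br r \<tau> (of_nat (Suc m)) \<noteq> 0" "br r \<tau> (of_nat (Suc l)) \<noteq> 0"
          using nz1[of "Suc m"] nz1[of "Suc l"] k by auto
      qed
      then show ?thesis unfolding rec using from_below[OF 3(1)] from_above[OF 3(2)] 3(1) by simp
    qed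
    then show ?case by (simp add: c_def)
  qed
qed

section \<open>Fused dual vectors depend only on the total sign\<close>

lemma theta1_over_br: "Im \<tau> > 0 \<Longrightarrow> br r \<tau> z \<noteq> 0 \<Longrightarrow> theta1 (z / r) \<tau> / br r \<tau> z = 1 / Cnorm r \<tau>"
  by (simp add: br_def divide_simps)

text \<open>When two steps return to \<open>c\<close>, both middle heights \<open>c + 1\<close> and \<open>c - 1\<close> occur. By the addition formula,
  exchanging the signs changes the first product by a multiple of \<open>[c + 1] [v - 1] / [c + 1]\<close> and the second by the
  opposite multiple of \<open>[c - 1] [v - 1] / [c - 1]\<close>. Here the denominators \<open>[b]\<close> in the dual vectors are essential.\<close>

lemma psi_star_two_steps_return:
  fixes c :: int
  assumes "Im \<tau> > 0" "r \<noteq> 0" and nz: "br r \<tau> (of_int (c + 1)) \<noteq> 0" "br r \<tau> (of_int (c - 1)) \<noteq> 0"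
  shows "psi_star r \<tau> 1 v (c + 1) c * psi_star r \<tau> (- 1) (v - 1) c (c + 1) +
      psi_star r \<tau> 1 v (c - 1) c * psi_star r \<tau> (- 1) (v - 1) c (c - 1) =
    psi_star r \<tau> (- 1) v (c + 1) c * psi_star r \<tau> 1 (v - 1) c (c + 1) +
      psi_star r \<tau> (- 1) v (c - 1) c * psi_star r \<tau> 1 (v - 1) c (c - 1)"
proof -
  define x1 y1 x2 y2 where "x1 = (v + of_int c) / (2 * r)" and "y1 = (of_int c - v + 2) / (2 * r)"
    and "x2 = (of_int c - v) / (2 * r)" and "y2 = (of_int c + v - 2) / (2 * r)"
  have args: "(of_int (c + 1 - c) * (v - 1) + of_int (c + 1)) / (2 * r) = x1"
    "(of_int (c - (c + 1)) * (v - 1 - 1) + of_int c) / (2 * r) = y1"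
    "(of_int (c - 1 - c) * (v - 1) + of_int (c - 1)) / (2 * r) = x2"
    "(of_int (c - (c - 1)) * (v - 1 - 1) + of_int c) / (2 * r) = y2"
    by (simp_all add: x1_def y1_def x2_def y2_def algebra_simps)
  have sums: "x1 + y1 = of_int (c + 1) / r" "x1 - y1 = (v - 1) / r"
    "x2 + y2 = of_int (c - 1) / r" "x2 - y2 = - ((v - 1) / r)"
    using assms(2) by (simp_all add: x1_def y1_def x2_def y2_def field_simps)
  define f g where "f z = theta3 z (\<tau> / 2)" and "g z = theta0 z (\<tau> / 2)" for z
  define K where "K = (Cnorm r \<tau>)\<^sup>2 * (Cnorm r \<tau>)\<^sup>2 / (4 * br r \<tau> (of_int c) * br r \<tau> v * br r \<tau> (v - 1))"
  define b1 b2 where "b1 = br r \<tau> (of_int (c + 1))" and "b2 = br r \<tau> (of_int (c - 1))"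
  have 1: "f x1 * g y1 - g x1 * f y1 = - 2 * theta1 (of_int (c + 1) / r) \<tau> * theta1 ((v - 1) / r) \<tau>"
    using theta_addition[OF assms(1), of x1 y1] unfolding sums f_def g_def by simp
  have 2: "f x2 * g y2 - g x2 * f y2 = 2 * theta1 (of_int (c - 1) / r) \<tau> * theta1 ((v - 1) / r) \<tau>"
    using theta_addition[OF assms(1), of x2 y2] unfolding sums f_def g_def theta1_minus by simp
  have "(f x1 * g y1 - g x1 * f y1) / b1 + (f x2 * g y2 - g x2 * f y2) / b2 =
      2 * theta1 ((v - 1) / r) \<tau> * (theta1 (of_int (c - 1) / r) \<tau> / b2 - theta1 (of_int (c + 1) / r) \<tau> / b1)"
    unfolding 1 2 by (simp add: algebra_simps)
  also have "\<dots> = 0"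
    using theta1_over_br[OF assms(1) nz(1)] theta1_over_br[OF assms(1) nz(2)] by (simp add: b1_def b2_def)
  finally have key: "K * (f x1 * g y1 / b1 + f x2 * g y2 / b2) = K * (g x1 * f y1 / b1 + g x2 * f y2 / b2)"
    by (simp add: diff_divide_distrib algebra_simps)
  have "psi_star r \<tau> 1 v (c + 1) c * psi_star r \<tau> (- 1) (v - 1) c (c + 1) +
      psi_star r \<tau> 1 v (c - 1) c * psi_star r \<tau> (- 1) (v - 1) c (c - 1) = K * (f x1 * g y1 / b1 + f x2 * g y2 / b2)"
    unfolding psi_star_def psi_def args K_def f_def[symmetric] g_def[symmetric] b1_def[symmetric] b2_def[symmetric]
    by (simp add: distrib_left add_divide_distrib mult_ac)
  moreover have "psi_star r \<tau> (- 1) v (c + 1) c * psi_star r \<tau> 1 (v - 1) c (c + 1) +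
      psi_star r \<tau> (- 1) v (c - 1) c * psi_star r \<tau> 1 (v - 1) c (c - 1) = K * (g x1 * f y1 / b1 + g x2 * f y2 / b2)"
    unfolding psi_star_def psi_def args K_def f_def[symmetric] g_def[symmetric] b1_def[symmetric] b2_def[symmetric]
    by (simp add: distrib_left add_divide_distrib mult_ac)
  ultimately show ?thesis using key by simp
qed

text \<open>For two steps in the same direction the decrease of the spectral parameter compensates the change of height:
  both theta functions have the same argument, so the product is symmetric in the signs.\<close>

lemma psi_star_two_steps_straight:
  fixes c d e :: int
  assumes "d - c = e - d" "\<bar>d - c\<bar> = 1"
  shows "psi_star r \<tau> \<epsilon> v d c * psi_star r \<tau> \<epsilon>' (v - 1) e d =
    psi_star r \<tau> \<epsilon>' v d c * psi_star r \<tau> \<epsilon> (v - 1) e d"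
proof -
  define z where "z = (of_int (d - c) * (v - 1) + of_int d) / (2 * r)"
  have arg: "(of_int (e - d) * (v - 1 - 1) + of_int e) / (2 * r) = z"
  proof -
    have "d = c + 1 \<and> e = c + 2 \<or> d = c - 1 \<and> e = c - 2" using assms by arith
    then show ?thesis by (auto simp: z_def algebra_simps)
  qed
  then show ?thesis
    unfolding psi_star_def psi_def arg z_def[symmetric] by (simp add: mult_ac)
qed

text \<open>The dual vectors along a sign sequence, with the spectral parameter \<open>v\<close> of the first step as parameter.
  Unlike \<open>u\<close>, it is unchanged when a last step is removed.\<close>

definition dual_sum :: "complex \<Rightarrow> complex \<Rightarrow> (nat \<Rightarrow> int) \<Rightarrow> complex \<Rightarrow> nat \<Rightarrow> int \<Rightarrow> int \<Rightarrow> complex" where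
  "dual_sum r \<tau> \<epsilon> v = path_sum (\<lambda>i x y. psi_star r \<tau> (\<epsilon> i) (v - of_nat i) y x)"

lemma dual_sum_Suc:
  "dual_sum r \<tau> \<epsilon> v (Suc k) b c =
     dual_sum r \<tau> \<epsilon> v k b (c - 1) * psi_star r \<tau> (\<epsilon> k) (v - of_nat k) c (c - 1) +
     dual_sum r \<tau> \<epsilon> v k b (c + 1) * psi_star r \<tau> (\<epsilon> k) (v - of_nat k) c (c + 1)"
  unfolding dual_sum_def by (rule path_sum_Suc)

lemma dual_sum_cong:
  "(\<And>i. i < k \<Longrightarrow> \<epsilon> i = \<epsilon>' i) \<Longrightarrow> dual_sum r \<tau> \<epsilon> v k b c = dual_sum r \<tau> \<epsilon>' v k b c"
  unfolding dual_sum_def by (intro path_sum_cong) simp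

text \<open>Only the last two steps are affected. Grouping the paths by the height before them, \<open>c - 2\<close>, \<open>c\<close> or
  \<open>c + 2\<close>, reduces the claim to the two identities for two steps.\<close>

lemma dual_sum_swap:
  assumes "Im \<tau> > 0" "r \<noteq> 0"
    and nz: "\<And>j. \<bar>j\<bar> \<le> int k + 1 \<Longrightarrow> br r \<tau> (of_int (b + j)) \<noteq> 0"
    and same: "\<And>i. i < k \<Longrightarrow> \<epsilon> i = \<epsilon>' i"
    and swap: "\<epsilon> k = 1" "\<epsilon> (Suc k) = - 1" "\<epsilon>' k = - 1" "\<epsilon>' (Suc k) = 1"
  shows "dual_sum r \<tau> \<epsilon> v (Suc (Suc k)) b c = dual_sum r \<tau> \<epsilon>' v (Suc (Suc k)) b c"
proof -
  define D where "D = dual_sum r \<tau> \<epsilon> v k b"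
  define w where "w = v - of_nat k"
  define s where "s = psi_star r \<tau>"
  have D': "dual_sum r \<tau> \<epsilon>' v k b = D"
    unfolding D_def by (rule ext, rule dual_sum_cong) (simp add: same)
  have w': "v - of_nat (Suc k) = w - 1" by (simp add: w_def)
  have expand: "dual_sum r \<tau> \<eta> v (Suc (Suc k)) b c =
      D (c - 2) * (s (\<eta> k) w (c - 1) (c - 2) * s (\<eta> (Suc k)) (w - 1) c (c - 1)) +
      D c * (s (\<eta> k) w (c + 1) c * s (\<eta> (Suc k)) (w - 1) c (c + 1) +
             s (\<eta> k) w (c - 1) c * s (\<eta> (Suc k)) (w - 1) c (c - 1)) +
      D (c + 2) * (s (\<eta> k) w (c + 1) (c + 2) * s (\<eta> (Suc k)) (w - 1) c (c + 1))"
    if "dual_sum r \<tau> \<eta> v k b = D" for \<eta>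
    unfolding dual_sum_Suc that w_def[symmetric] w' s_def[symmetric] by (simp add: algebra_simps)
  have middle: "D c * (s 1 w (c + 1) c * s (- 1) (w - 1) c (c + 1) + s 1 w (c - 1) c * s (- 1) (w - 1) c (c - 1)) =
      D c * (s (- 1) w (c + 1) c * s 1 (w - 1) c (c + 1) + s (- 1) w (c - 1) c * s 1 (w - 1) c (c - 1))"
    \<comment> \<open>The heights \<open>c + 1\<close> and \<open>c - 1\<close> are covered by genericity only if \<open>c\<close> is reachable from \<open>b\<close>.\<close>
  proof (cases "\<bar>c - b\<bar> \<le> int k")
    case True
    then have "br r \<tau> (of_int (c + 1)) \<noteq> 0" "br r \<tau> (of_int (c - 1)) \<noteq> 0"
      using nz[of "c + 1 - b"] nz[of "c - 1 - b"] by auto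
    then show ?thesis
      unfolding s_def using psi_star_two_steps_return[OF assms(1,2)] by simp
  next
    case False
    then have "D c = 0"
      unfolding D_def dual_sum_def by (intro path_sum_eq_0) simp
    then show ?thesis by simp
  qed
  have outer: "s 1 w (c - 1) (c - 2) * s (- 1) (w - 1) c (c - 1) = s (- 1) w (c - 1) (c - 2) * s 1 (w - 1) c (c - 1)"
    "s 1 w (c + 1) (c + 2) * s (- 1) (w - 1) c (c + 1) = s (- 1) w (c + 1) (c + 2) * s 1 (w - 1) c (c + 1)"
    unfolding s_def by (rule psi_star_two_steps_straight; simp)+
  show ?thesis
    unfolding expand[OF D_def[symmetric]] expand[OF D'] swap middle outer ..
qed

text \<open>Induction on the last step. If the last signs agree, the induction hypothesis applies to the rest.
  Otherwise one sequence ends in \<open>1\<close> and the other in \<open>-1\<close>. The first one then contains some \<open>-1\<close>, which the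
  induction hypothesis moves to the last place but one, and \<open>dual_sum_swap\<close> moves to the end.\<close>

lemma dual_sum_depends_on_weight:
  fixes \<epsilon> \<epsilon>' :: "nat \<Rightarrow> int"
  assumes "Im \<tau> > 0" "r \<noteq> 0"
    and "\<And>j. \<bar>j\<bar> < int k \<Longrightarrow> br r \<tau> (of_int (b + j)) \<noteq> 0"
    and "\<And>i. i < k \<Longrightarrow> \<epsilon> i \<in> {1, - 1}" "\<And>i. i < k \<Longrightarrow> \<epsilon>' i \<in> {1, - 1}"
    and "(\<Sum>i<k. \<epsilon> i) = (\<Sum>i<k. \<epsilon>' i)"
  shows "dual_sum r \<tau> \<epsilon> v k b c = dual_sum r \<tau> \<epsilon>' v k b c"
  using assms(3-)
proof (induction k arbitrary: \<epsilon> \<epsilon>' c)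
  case 0
  then show ?case by (simp add: dual_sum_def path_sum_0)
next
  case (Suc k)
  have IH: "dual_sum r \<tau> \<eta> v k b d = dual_sum r \<tau> \<eta>' v k b d"
    if "\<And>i. i < k \<Longrightarrow> \<eta> i \<in> {1, - 1}" "\<And>i. i < k \<Longrightarrow> \<eta>' i \<in> {1, - 1}" "(\<Sum>i<k. \<eta> i) = (\<Sum>i<k. \<eta>' i)"
    for \<eta> \<eta>' d
    using Suc.IH[of \<eta> \<eta>'] Suc.prems(1) that by simp
  have same_last: "dual_sum r \<tau> \<eta> v (Suc k) b c = dual_sum r \<tau> \<eta>' v (Suc k) b c"
    if "\<And>i. i < k \<Longrightarrow> \<eta> i \<in> {1, - 1}" "\<And>i. i < k \<Longrightarrow> \<eta>' i \<in> {1, - 1}" "(\<Sum>i<k. \<eta> i) = (\<Sum>i<k. \<eta>' i)"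
      "\<eta> k = \<eta>' k" for \<eta> \<eta>'
    unfolding dual_sum_Suc using IH[OF that(1-3)] that(4) by simp
  have differ_last: "dual_sum r \<tau> \<eta> v (Suc k) b c = dual_sum r \<tau> \<eta>' v (Suc k) b c"
    if \<eta>: "\<And>i. i < k \<Longrightarrow> \<eta> i \<in> {1, - 1}" and \<eta>': "\<And>i. i < k \<Longrightarrow> \<eta>' i \<in> {1, - 1}"
      and total: "(\<Sum>i<Suc k. \<eta> i) = (\<Sum>i<Suc k. \<eta>' i)" and last: "\<eta> k = 1" "\<eta>' k = - 1" for \<eta> \<eta>'
  proof -
    have "\<eta>' i \<le> 1" if "i < k" for i using \<eta>'[OF that] by auto
    then have "(\<Sum>i<k. \<eta>' i) \<le> (\<Sum>i<k. 1)"
      by (intro sum_mono) simp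
    then have "(\<Sum>i<k. \<eta> i) < int k" using total last by simp
    have "\<exists>j<k. \<eta> j = - 1"
    proof (rule ccontr)
      assume "\<not> (\<exists>j<k. \<eta> j = - 1)"
      then have "(\<Sum>i<k. \<eta> i) = (\<Sum>i<k. 1)" using \<eta> by (intro sum.cong) auto
      with \<open>(\<Sum>i<k. \<eta> i) < int k\<close> show False by simp
    qed
    then obtain j where j: "j < k" "\<eta> j = - 1" by blast
    then obtain l where k: "k = Suc l" by (cases k) auto
    \<comment> \<open>The transposition of \<open>j\<close> and \<open>l\<close> brings the sign \<open>- 1\<close> to place \<open>l\<close>.\<close>
    define t where "t i = (if i = j then l else if i = l then j else i)" for i
    define \<eta>1 where "\<eta>1 = (\<lambda>i. \<eta> (t i))"
    define \<eta>2 where "\<eta>2 = \<eta>1(l := 1, k := - 1)"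
    have \<eta>1_vals: "\<eta>1 i \<in> {1, - 1}" if "i < k" for i
      using \<eta> that j k by (auto simp: \<eta>1_def t_def)
    have \<eta>1_sum: "(\<Sum>i<k. \<eta> i) = (\<Sum>i<k. \<eta>1 i)"
      by (rule sum.reindex_bij_witness[of _ t t]) (use j k in \<open>auto simp: \<eta>1_def t_def\<close>)
    have \<eta>1_last: "\<eta>1 l = - 1" "\<eta>1 k = 1"
      using j k last by (auto simp: \<eta>1_def t_def)
    have "dual_sum r \<tau> \<eta> v (Suc k) b c = dual_sum r \<tau> \<eta>1 v (Suc k) b c"
      using \<eta> \<eta>1_vals \<eta>1_sum last \<eta>1_last by (intro same_last) auto
    also have "\<dots> = dual_sum r \<tau> \<eta>2 v (Suc k) b c"
      unfolding k
      by (rule dual_sum_swap[OF assms(1,2), symmetric])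
        (use Suc.prems(1) \<eta>1_last in \<open>auto simp: \<eta>2_def k\<close>)
    also have "\<dots> = dual_sum r \<tau> \<eta>' v (Suc k) b c"
    proof (rule same_last)
      show "\<eta>2 i \<in> {1, - 1}" if "i < k" for i
        using \<eta>1_vals[OF that] that by (auto simp: \<eta>2_def)
      have "(\<Sum>i<k. \<eta>2 i) = (\<Sum>i<l. \<eta>1 i) + 1"
        by (simp add: k \<eta>2_def)
      moreover have "(\<Sum>i<k. \<eta>1 i) = (\<Sum>i<l. \<eta>1 i) - 1"
        by (simp add: k \<eta>1_last)
      ultimately show "(\<Sum>i<k. \<eta>2 i) = (\<Sum>i<k. \<eta>' i)"
        using \<eta>1_sum total last by simp
    qed (use \<eta>' last in \<open>auto simp: \<eta>2_def\<close>)
    finally show ?thesis .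
  qed
  note vals = Suc.prems(2,3) and total = Suc.prems(4)
  consider "\<epsilon> k = \<epsilon>' k" | "\<epsilon> k = 1" "\<epsilon>' k = - 1" | "\<epsilon> k = - 1" "\<epsilon>' k = 1"
    using vals[of k] by auto
  then show ?case
  proof cases
    case 1
    then show ?thesis using vals total by (intro same_last) auto
  next
    case 2
    then show ?thesis using vals total by (intro differ_last) auto
  next
    case 3
    then show ?thesis using vals total by (intro differ_last[symmetric]) auto
  qed
qed

lemma sum_signs_in_fusion_weights:
  assumes "\<And>i. i < k \<Longrightarrow> \<epsilon> i \<in> {1, - 1 :: int}"
  shows "(\<Sum>i<k. \<epsilon> i) \<in> fusion_weights k"
proof -
  have "(\<Sum>i<k. \<epsilon> i) = (\<Sum>i<k. (if \<epsilon> i = 1 then 2 else 0) - 1)"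
    using assms by (intro sum.cong) auto
  also have "\<dots> = 2 * int (card {i \<in> {..<k}. \<epsilon> i = 1}) - int k"
    by (simp add: sum_subtractf sum.If_cases Int_def)
  finally show ?thesis
    unfolding fusion_weights_def using card_mono[of "{..<k}" "{i \<in> {..<k}. \<epsilon> i = 1}"] by auto
qed

text \<open>Independence of the sign sequence makes a value exist in the definite description, and the member \<open>\<epsilon>\<close> of
  \<open>sign_seqs k \<mu>\<close> makes it unique.\<close>

lemma psi_star_fused_eq:
  assumes "Im \<tau> > 0" "r \<noteq> 0"
    and "\<And>j. \<bar>j\<bar> < int k \<Longrightarrow> br r \<tau> (of_int (b + j)) \<noteq> 0"
    and \<epsilon>: "\<epsilon> \<in> sign_seqs k \<mu>"
  shows "psi_star_fused r \<tau> k \<mu> u c b = dual_sum r \<tau> \<epsilon> (u + of_nat k - 1) k b c"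
proof -
  have along: "psi_star_along r \<tau> k \<eta> u c b = dual_sum r \<tau> \<eta> (u + of_nat k - 1) k b c" for \<eta>
    by (simp add: psi_star_along_def dual_sum_def path_sum_def)
  have "psi_star_along r \<tau> k \<eta> u c b = dual_sum r \<tau> \<epsilon> (u + of_nat k - 1) k b c"
    if "\<eta> \<in> sign_seqs k \<mu>" for \<eta>
    unfolding along
    by (rule dual_sum_depends_on_weight[OF assms(1-3)])
      (use \<epsilon> that in \<open>auto simp: sign_seqs_def PiE_def Pi_def\<close>)
  then show ?thesis
    unfolding psi_star_fused_def using \<epsilon> by (intro the_equality) auto
qed

section \<open>Pairing the fused vectors\<close>

text \<open>A path of \<open>k\<close> steps that climbs by \<open>k\<close> has no choice.\<close>

lemma height_paths_straight: "height_paths k a (a + int k) = {\<lambda>i\<in>{..k}. a + int i}"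
proof (intro equalityI subsetI)
  fix h assume "h \<in> height_paths k a (a + int k)"
  then have ends: "h 0 = a" "h k = a + int k" and steps: "\<And>i. i < k \<Longrightarrow> \<bar>h i - h (Suc i)\<bar> = 1"
    and ext: "h \<in> extensional {..k}"
    by (auto simp: height_paths_def PiE_def)
  have le: "h i \<le> a + int i" if "i \<le> k" for i
    using that
  proof (induction i)
    case (Suc i)
    then show ?case using steps[of i] by auto
  qed (simp add: ends)
  have ge: "a + int i \<le> h i" if "i \<le> k" for i
    using that
  proof (induction rule: inc_induct)
    case (step i)
    then show ?case using steps[of i] by auto
  qed (simp add: ends)
  have "h = (\<lambda>i\<in>{..k}. a + int i)"
    using ext by (intro extensionalityI) (auto intro!: antisym le ge)
  then show "h \<in> {\<lambda>i\<in>{..k}. a + int i}" by simp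
qed (auto simp: height_paths_def)

lemma psi_fused_straight:
  "psi_fused r \<tau> k \<mu> u a (a + int k) =
     (\<Sum>\<epsilon>\<in>sign_seqs k \<mu>. \<Prod>i<k. psi r \<tau> (\<epsilon> i) (u + of_nat k - 1 - of_nat i) (a + int i) (a + int i + 1))"
proof -
  have "psi_fused r \<tau> k \<mu> u a (a + int k) = psi_along r \<tau> k \<mu> u (\<lambda>i\<in>{..k}. a + int i)"
    unfolding psi_fused_def height_paths_straight by (intro the_equality) auto
  also have "\<dots> = (\<Sum>\<epsilon>\<in>sign_seqs k \<mu>. \<Prod>i<k. psi r \<tau> (\<epsilon> i) (u + of_nat k - 1 - of_nat i) (a + int i) (a + int i + 1))"
    unfolding psi_along_def by (intro sum.cong prod.cong) (auto simp: add_ac)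
  finally show ?thesis .
qed

text \<open>In the sum over \<open>sign_seqs k \<mu>\<close> that defines \<open>psi_fused\<close>, the dual vector may be computed with the same
  sign sequence. Then the sums over \<open>\<mu>\<close> and over \<open>sign_seqs k \<mu>\<close> merge into a sum over all sign sequences, which
  factors along each path.\<close>

lemma fused_pairing_eq_path_sum:
  fixes r \<tau> u :: complex and k :: nat
  assumes "Im \<tau> > 0" "r \<noteq> 0"
    and "\<And>j. \<bar>j\<bar> < int k \<Longrightarrow> br r \<tau> (of_int (b + j)) \<noteq> 0"
  defines "v \<equiv> u + of_nat k - 1"
  shows "(\<Sum>\<mu>\<in>fusion_weights k. psi_star_fused r \<tau> k \<mu> u c b * psi_fused r \<tau> k \<mu> u a (a + int k)) =
    path_sum (\<lambda>i x y. \<Sum>\<epsilon>\<in>{1, - 1}. psi_star r \<tau> \<epsilon> (v - of_nat i) y x *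
      psi r \<tau> \<epsilon> (v - of_nat i) (a + int i) (a + int i + 1)) k b c"
proof -
  define X where "X = {..<k} \<rightarrow>\<^sub>E {1, - 1 :: int}"
  define p where "p i e = psi r \<tau> e (v - of_nat i) (a + int i) (a + int i + 1)" for i e
  define s where "s i e x y = psi_star r \<tau> e (v - of_nat i) y x" for i e x y
  have fin: "finite X" unfolding X_def by (intro finite_PiE) auto
  have "(\<Sum>\<mu>\<in>fusion_weights k. psi_star_fused r \<tau> k \<mu> u c b * psi_fused r \<tau> k \<mu> u a (a + int k)) =
      (\<Sum>\<mu>\<in>fusion_weights k. \<Sum>\<epsilon>\<in>sign_seqs k \<mu>. dual_sum r \<tau> \<epsilon> v k b c * (\<Prod>i<k. p i (\<epsilon> i)))"
    unfolding psi_fused_straight sum_distrib_left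
    by (intro sum.cong) (simp_all add: psi_star_fused_eq[OF assms(1-3)] v_def p_def)
  also have "\<dots> = (\<Sum>\<mu>\<in>fusion_weights k. \<Sum>\<epsilon>\<in>{\<epsilon> \<in> X. (\<Sum>i<k. \<epsilon> i) = \<mu>}. dual_sum r \<tau> \<epsilon> v k b c * (\<Prod>i<k. p i (\<epsilon> i)))"
    by (simp add: sign_seqs_def X_def)
  also have "\<dots> = (\<Sum>\<epsilon>\<in>X. dual_sum r \<tau> \<epsilon> v k b c * (\<Prod>i<k. p i (\<epsilon> i)))"
  proof (rule sum.group[OF fin])
    show "finite (fusion_weights k)" by (simp add: fusion_weights_def)
    show "(\<lambda>\<epsilon>. \<Sum>i<k. \<epsilon> i) ` X \<subseteq> fusion_weights k"
      unfolding X_def by (auto intro!: sum_signs_in_fusion_weights)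
  qed
  also have "\<dots> = (\<Sum>\<epsilon>\<in>X. \<Sum>h\<in>height_paths k b c. \<Prod>i<k. s i (\<epsilon> i) (h i) (h (Suc i)) * p i (\<epsilon> i))"
    by (simp add: dual_sum_def path_sum_def s_def sum_distrib_right prod.distrib)
  also have "\<dots> = (\<Sum>h\<in>height_paths k b c. \<Sum>\<epsilon>\<in>X. \<Prod>i<k. s i (\<epsilon> i) (h i) (h (Suc i)) * p i (\<epsilon> i))"
    by (rule sum.swap)
  also have "\<dots> = (\<Sum>h\<in>height_paths k b c. \<Prod>i<k. \<Sum>e\<in>{1, - 1}. s i e (h i) (h (Suc i)) * p i e)"
    unfolding X_def by (subst prod_sum_PiE) auto
  finally show ?thesis by (simp add: path_sum_def s_def p_def)
qed

theorem theorem3p3: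
  fixes r \<tau> u \<alpha> \<beta> \<gamma> :: complex
    and k n :: nat
    and a b c :: int
  assumes "Im \<tau> > 0"
    and "r \<noteq> 0"
    and "k \<ge> 1"
    and "n \<le> k"
    and "b - c = int k - 2 * int n"
    and "generic_params r \<tau> k u b"
    and "\<alpha> = (- u + of_int a - of_nat k + 1) / 2"
    and "\<beta> = (- u + of_int b - of_nat k + 1) / 2"
    and "\<gamma> = (- u - of_int b - of_nat k + 1) / 2"
  shows "ell_binom r \<tau> k n \<alpha> \<beta> \<gamma> =
    (\<Sum>\<mu>\<in>fusion_weights k.
       psi_star_fused r \<tau> k \<mu> u c b * psi_fused r \<tau> k \<mu> u a (a + int k))"
proof -
  define v where "v = u + of_nat k - 1"
  define w where "w i x y = (\<Sum>\<epsilon>\<in>{1, - 1}. psi_star r \<tau> \<epsilon> (v - of_nat i) y x *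
      psi r \<tau> \<epsilon> (v - of_nat i) (a + int i) (a + int i + 1))" for i x y
  have nz_b: "br r \<tau> (of_int (b + j)) \<noteq> 0" if "\<bar>j\<bar> < int k" for j
  proof -
    have "j \<in> {1 - int k..int k - 1}" using that by auto
    then show ?thesis
      using assms(6) br_eq_0_imp_period[OF assms(1), of r "of_int b + of_int j"]
      by (auto simp: generic_params_def)
  qed
  have nz_1: "br r \<tau> (of_nat j) \<noteq> 0" if "1 \<le> j" "j \<le> k" for j
    using assms(6) that br_eq_0_imp_period[OF assms(1), of r "of_nat j"]
    by (auto simp: generic_params_def)
  have c: "c = b - int k + 2 * int n" using assms(5) by simp
  have "path_sum w k b c = ell_binom r \<tau> k n \<alpha> \<beta> \<gamma>"
    unfolding c
  proof (rule path_sum_eq_ell_binom[OF assms(1)])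
    show "\<alpha> = (of_int a - v) / 2" "\<beta> = (of_int b - v) / 2" "\<gamma> = (- of_int b - v) / 2"
      by (simp_all add: assms(7-9) v_def)
    show "w i h (h + 1) = br r \<tau> ((of_int h + of_int a + of_nat i) / 2) *
        br r \<tau> ((of_int h - of_int a - of_nat i) / 2 + (v - of_nat i)) / (br r \<tau> (of_int h) * br r \<tau> (v - of_nat i))" for i h
      using psi_pairing[OF assms(1,2), of 1 "v - of_nat i" h "a + int i"]
      by (simp add: w_def field_simps)
    show "w i h (h - 1) = - br r \<tau> ((of_int h + of_int a + of_nat i) / 2 - (v - of_nat i)) *
        br r \<tau> ((of_int h - of_int a - of_nat i) / 2) / (br r \<tau> (of_int h) * br r \<tau> (v - of_nat i))" for i h
      using psi_pairing[OF assms(1,2), of "- 1" "v - of_nat i" h "a + int i"]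
      by (simp add: w_def field_simps)
  qed (use nz_b nz_1 assms(4) in auto)
  then show ?thesis
    using fused_pairing_eq_path_sum[OF assms(1,2) nz_b, of k u c a]
    by (simp add: w_def[abs_def] v_def)
qed

end
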